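(* Let $N$ be the completely solvable 6-dimensional Nakamura manifold. Every leaf of the special Lagrangian foliations $\mathcal L_{234}$ and $\mathcal L_{456}$ of $N$ is diffeomorphic to a real 3-torus.
   Context: Completely solvable Nakamura manifold $N$. Let $\lambda\in\mathbb R\setminus\{0\}$, $M\in SL(2,\mathbb Z)$ and $P\in GL(2,\mathbb R)$ with $PMP^{-1}=\mathrm{diag}(e^{\lambda},e^{-\lambda})$, and $\tau\in\mathbb R\setminus\{0\}$. Let $G=\mathbb C\ltimes_\rho\mathbb C^2$ with coordinates $(w,z_1,z_2)$, $w=x+iy$, $z_k=x_k+iy_k$, and product $(w',z_1',z_2')*(w,z_1,z_2)=(w'+w,\,e^{\lambda\mathrm{Re}\,w'}z_1+z_1',\,e^{-\lambda\mathrm{Re}\,w'}z_2+z_2')$. Let $\Gamma=(\mathbb Z\oplus\tau\sqrt{-1}\,\mathbb Z)\ltimes_\rho(P\mathbb Z^2\oplus\sqrt{-1}P\mathbb Z^2)$ and $N=\Gamma\backslash G$. Points of $N$ are written $[x,x_1,x_2,y,y_1,y_2]$. The leaves of $\mathcal L_{234}$ are the sets $\{[A,x_1,x_2,y,B,C]: x_1,x_2,y\in\mathbb R\}$ and those of $\mathcal L_{456}$ are the sets $\{[A,B,C,y,y_1,y_2]: y,y_1,y_2\in\mathbb R\}$, for real constants $A,B,C$. They are special Lagrangian of angle $-\pi/2$ for $\Omega=\varphi^0\wedge\varphi^1\wedge\varphi^2$, $\omega=\frac i2\sum_k\varphi^k\wedge\bar\varphi^k$, where $\varphi^0=dw$,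 $\varphi^1=e^{-\lambda x}dz_1$, $\varphi^2=e^{\lambda x}dz_2$. *)

theory Defs
  imports "HOL-Analysis.Analysis" "HOL-Algebra.Coset"
begin

section \<open>Smooth maps between open subsets of normed spaces\<close>

text \<open>
  A map is \<open>C\<^sup>k\<^sup>+\<^sup>1\<close> if it is differentiable and each of its directional derivatives is \<open>C\<^sup>k\<close>;
  on finite-dimensional spaces this is the usual notion. The predicates are meant for open
  \<open>S\<close> only.
\<close>

primrec Ck_on :: "nat \<Rightarrow> 'a::real_normed_vector set \<Rightarrow> ('a \<Rightarrow> 'b::real_normed_vector) \<Rightarrow> bool" where
  "Ck_on 0 S f \<longleftrightarrow> continuous_on S f"
| "Ck_on (Suc k) S f \<longleftrightarrow>
     (\<exists>f'. (\<forall>x\<in>S. (f has_derivative f' x) (at x)) \<and> (\<forall>v. Ck_on k S (\<lambda>x. f' x v)))"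

definition smooth_on :: "'a::real_normed_vector set \<Rightarrow> ('a \<Rightarrow> 'b::real_normed_vector) \<Rightarrow> bool" where
  "smooth_on S f \<longleftrightarrow> (\<forall>k. Ck_on k S f)"


section \<open>Smooth manifolds\<close>

text \<open>A chart is a pair of a domain and a map, whose values outside the domain are irrelevant.\<close>

type_synonym ('a, 'e) chart = "'a set \<times> ('a \<Rightarrow> 'e)"

type_synonym ('a, 'e) manifold = "'a topology \<times> ('a, 'e) chart set"

definition is_chart :: "'a topology \<Rightarrow> ('a, 'e::euclidean_space) chart \<Rightarrow> bool" where
  "is_chart X = (\<lambda>(U, \<phi>). openin X U \<and> open (\<phi> ` U) \<and>
     homeomorphic_map (subtopology X U) (top_of_set (\<phi> ` U)) \<phi>)"

text \<open>
  The coordinate expression of a map with respect to two charts. For \<open>f = id\<close> this is the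
  transition map.
\<close>

definition smooth_in_charts ::
  "('a, 'e::euclidean_space) chart \<Rightarrow> ('b, 'f::euclidean_space) chart \<Rightarrow> ('a \<Rightarrow> 'b) \<Rightarrow> bool" where
  "smooth_in_charts = (\<lambda>(U, \<phi>) (V, \<psi>) f.
     smooth_on (\<phi> ` (U \<inter> f -` V)) (\<psi> \<circ> f \<circ> the_inv_into U \<phi>))"

definition compatible_charts ::
  "('a, 'e::euclidean_space) chart \<Rightarrow> ('a, 'f::euclidean_space) chart \<Rightarrow> bool" where
  "compatible_charts c d \<longleftrightarrow> smooth_in_charts c d id \<and> smooth_in_charts d c id"

definition smooth_manifold :: "('a, 'e::euclidean_space) manifold \<Rightarrow> bool" where
  "smooth_manifold = (\<lambda>(X, \<A>).
     Hausdorff_space X \<and> second_countable X \<and>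
     (\<forall>c\<in>\<A>. is_chart X c) \<and>
     (\<Union>c\<in>\<A>. fst c) = topspace X \<and>
     (\<forall>c\<in>\<A>. \<forall>d\<in>\<A>. compatible_charts c d))"

definition smooth_map ::
  "('a, 'e::euclidean_space) manifold \<Rightarrow> ('b, 'f::euclidean_space) manifold \<Rightarrow> ('a \<Rightarrow> 'b) \<Rightarrow> bool" where
  "smooth_map = (\<lambda>(X, \<A>) (Y, \<B>) f.
     continuous_map X Y f \<and> (\<forall>c\<in>\<A>. \<forall>d\<in>\<B>. smooth_in_charts c d f))"

definition diffeomorphism ::
  "('a, 'e::euclidean_space) manifold \<Rightarrow> ('b, 'f::euclidean_space) manifold \<Rightarrow> ('a \<Rightarrow> 'b) \<Rightarrow> bool" where
  "diffeomorphism M N f \<longleftrightarrow> smooth_map M N f \<and>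
     (\<exists>g. smooth_map N M g \<and>
        (\<forall>p\<in>topspace (fst M). g (f p) = p) \<and> (\<forall>q\<in>topspace (fst N). f (g q) = q))"

text \<open>Both sides are required to be genuine smooth manifolds.\<close>

definition diffeomorphic ::
  "('a, 'e::euclidean_space) manifold \<Rightarrow> ('b, 'f::euclidean_space) manifold \<Rightarrow> bool" where
  "diffeomorphic M N \<longleftrightarrow> smooth_manifold M \<and> smooth_manifold N \<and> (\<exists>f. diffeomorphism M N f)"


section \<open>Submanifolds\<close>

definition maximal_atlas :: "('a, 'e::euclidean_space) manifold \<Rightarrow> ('a, 'e) chart set" where
  "maximal_atlas = (\<lambda>(X, \<A>). {c. is_chart X c \<and> (\<forall>d\<in>\<A>. compatible_charts c d)})"

text \<open>
  The structure that an embedded submanifold \<open>S\<close> inherits from the ambient manifold: the subspace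
  topology, and the charts obtained from the slice charts of \<open>S\<close>, i.e. those charts that map
  \<open>S\<close> onto the trace of an affine subspace \<open>E\<close>, which is identified with the model space \<open>'k\<close>
  by a linear map. The set \<open>S\<close> is an embedded submanifold with model space \<open>'k\<close> iff these charts
  cover \<open>S\<close>, hence iff the result satisfies \<^const>\<open>smooth_manifold\<close>.
\<close>

definition slice_charts ::
  "('a, 'e::euclidean_space) manifold \<Rightarrow> 'a set \<Rightarrow> ('a, 'k::euclidean_space) chart set" where
  "slice_charts M S = {(U \<inter> S, h \<circ> \<phi>) | U \<phi> h.
     (U, \<phi>) \<in> maximal_atlas M \<and> linear h \<and>
     (\<exists>E. affine E \<and> \<phi> ` (U \<inter> S) = \<phi> ` U \<inter> E \<and> bij_betw h E UNIV)}"

definition submanifold ::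
  "('a, 'e::euclidean_space) manifold \<Rightarrow> 'a set \<Rightarrow> ('a, 'k::euclidean_space) manifold" where
  "submanifold M S = (subtopology (fst M) S, slice_charts M S)"


section \<open>Quotients by discrete groups\<close>

definition quotient_topology :: "('e::topological_space \<Rightarrow> 'a) \<Rightarrow> 'a topology" where
  "quotient_topology \<pi> = topology (\<lambda>U. U \<subseteq> range \<pi> \<and> open (\<pi> -` U))"

lemma openin_quotient_topology:
  "openin (quotient_topology \<pi>) U \<longleftrightarrow> U \<subseteq> range \<pi> \<and> open (\<pi> -` U)"
proof -
  have "istopology (\<lambda>U. U \<subseteq> range \<pi> \<and> open (\<pi> -` U))"
    unfolding istopology_def by (auto simp: vimage_Union vimage_Int)
  thus ?thesis
    unfolding quotient_topology_def by simp
qed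

text \<open>
  The charts are the local inverses of the projection. If \<open>\<pi>\<close> is the projection to the orbits of a
  free and properly discontinuous group of diffeomorphisms, this is the unique smooth structure
  for which \<open>\<pi>\<close> is a local diffeomorphism.
\<close>

definition quotient_manifold :: "('e::euclidean_space \<Rightarrow> 'a) \<Rightarrow> ('a, 'e) manifold" where
  "quotient_manifold \<pi> =
     (quotient_topology \<pi>, {(\<pi> ` W, the_inv_into W \<pi>) | W. open W \<and> inj_on \<pi> W})"

definition integer_lattice :: "(real ^ 'n) set" where
  "integer_lattice = {v. \<forall>i. v $ i \<in> \<int>}"

definition additive_group :: "'a::ab_group_add monoid" where
  "additive_group = \<lparr>carrier = UNIV, mult = (+), one = 0\<rparr>"

definition torus :: "((real ^ 'n) set, real ^ 'n) manifold" where
  "torus = quotient_manifold (\<lambda>v. integer_lattice #>\<^bsub>additive_group\<^esub> v)"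


section \<open>The completely solvable Nakamura manifold\<close>

definition nakamura_group :: "real \<Rightarrow> (complex \<times> complex \<times> complex) monoid" where
  "nakamura_group lam =
     \<lparr>carrier = UNIV,
      mult = (\<lambda>(w', z\<^sub>1', z\<^sub>2') (w, z\<^sub>1, z\<^sub>2).
        (w' + w,
         of_real (exp (lam * Re w')) * z\<^sub>1 + z\<^sub>1',
         of_real (exp (- lam * Re w')) * z\<^sub>2 + z\<^sub>2')),
      one = (0, 0, 0)\<rparr>"

lemma group_nakamura_group: "group (nakamura_group lam)"
proof (rule groupI)
  fix p assume "p \<in> carrier (nakamura_group lam)"
  obtain w z\<^sub>1 z\<^sub>2 where p: "p = (w, z\<^sub>1, z\<^sub>2)"
    by (cases p)
  show "\<exists>q\<in>carrier (nakamura_group lam). q \<otimes>\<^bsub>nakamura_group lam\<^esub> p = \<one>\<^bsub>nakamura_group lam\<^esub>"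
    by (rule bexI[of _ "(- w, - of_real (exp (- lam * Re w)) * z\<^sub>1, - of_real (exp (lam * Re w)) * z\<^sub>2)"])
      (auto simp: p nakamura_group_def)
qed (auto simp: nakamura_group_def algebra_simps exp_add exp_diff exp_minus divide_simps)

definition nakamura_lattice :: "real ^ 2 ^ 2 \<Rightarrow> real \<Rightarrow> (complex \<times> complex \<times> complex) set" where
  "nakamura_lattice P \<tau> =
     {(Complex m (\<tau> * n), Complex (u $ 1) (v $ 1), Complex (u $ 2) (v $ 2)) | m n u v.
        m \<in> \<int> \<and> n \<in> \<int> \<and> u \<in> (*v) P ` integer_lattice \<and> v \<in> (*v) P ` integer_lattice}"

text \<open>
  The points of \<open>\<Gamma>\<setminus>G\<close> are the orbits of left multiplication by \<open>\<Gamma>\<close>, which HOL-Algebra calls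
  right cosets.
\<close>

definition nakamura_proj ::
  "real \<Rightarrow> real ^ 2 ^ 2 \<Rightarrow> real \<Rightarrow> complex \<times> complex \<times> complex \<Rightarrow> (complex \<times> complex \<times> complex) set" where
  "nakamura_proj lam P \<tau> p = nakamura_lattice P \<tau> #>\<^bsub>nakamura_group lam\<^esub> p"

definition nakamura_manifold ::
  "real \<Rightarrow> real ^ 2 ^ 2 \<Rightarrow> real
   \<Rightarrow> ((complex \<times> complex \<times> complex) set, complex \<times> complex \<times> complex) manifold" where
  "nakamura_manifold lam P \<tau> = quotient_manifold (nakamura_proj lam P \<tau>)"

text \<open>The point written \<open>[x, x\<^sub>1, x\<^sub>2, y, y\<^sub>1, y\<^sub>2]\<close>.\<close>

definition nakamura_point ::
  "real \<Rightarrow> real ^ 2 ^ 2 \<Rightarrow> real \<Rightarrow> real \<Rightarrow> real \<Rightarrow> real \<Rightarrow> real \<Rightarrow> real \<Rightarrow> real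
   \<Rightarrow> (complex \<times> complex \<times> complex) set" where
  "nakamura_point lam P \<tau> x x\<^sub>1 x\<^sub>2 y y\<^sub>1 y\<^sub>2 =
     nakamura_proj lam P \<tau> (Complex x y, Complex x\<^sub>1 y\<^sub>1, Complex x\<^sub>2 y\<^sub>2)"

text \<open>A foliation is represented by the set of its leaves.\<close>

definition foliation_234 ::
  "real \<Rightarrow> real ^ 2 ^ 2 \<Rightarrow> real \<Rightarrow> (complex \<times> complex \<times> complex) set set set" where
  "foliation_234 lam P \<tau> =
     {{nakamura_point lam P \<tau> A x\<^sub>1 x\<^sub>2 y B C | x\<^sub>1 x\<^sub>2 y. True} | A B C. True}"

definition foliation_456 ::
  "real \<Rightarrow> real ^ 2 ^ 2 \<Rightarrow> real \<Rightarrow> (complex \<times> complex \<times> complex) set set set" where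
  "foliation_456 lam P \<tau> =
     {{nakamura_point lam P \<tau> A B C y y\<^sub>1 y\<^sub>2 | y y\<^sub>1 y\<^sub>2. True} | A B C. True}"

end

theory Submission
  imports Defs
begin

text \<open>
  The leaf is covered by a 3-space. Let \<open>\<pi>\<close> be the projection of \<open>\<complex>\<^sup>3\<close> onto \<open>N\<close>, and let \<open>j\<close> parametrise
  a 3-plane lying over the leaf, affinely and in coordinates in which the elements of \<open>\<Gamma>\<close> that map
  the plane to itself are the integer translations. Then \<open>\<pi> \<circ> j\<close> maps \<open>\<real>\<^sup>3\<close> onto the leaf with the
  same fibres as the projection \<open>\<real>\<^sup>3 \<rightarrow> \<real>\<^sup>3/\<int>\<^sup>3\<close>, and passing to quotients gives a bijection
  between the leaf and the torus. What has to be seen is that it is a diffeomorphism for the structure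
  that the leaf inherits from \<open>N\<close>.

  The group enters as follows. An element of \<open>\<Gamma>\<close> whose translation of the coordinate \<open>x\<close> is an integer
  \<open>m \<noteq> 0\<close> moves the plane to a parallel plane at distance at least 1, and an element with
  \<open>m = 0\<close> is a pure translation by \<open>\<tau>\<int>\<close> and the lattice \<open>P\<int>\<^sup>2 \<oplus> iP\<int>\<^sup>2\<close>
  (\<open>proj_eq_iff_near\<close>). Hence the translates of the plane do not accumulate: a neighbourhood of the plane
  meets no translate other than the plane itself, and the leaf is embedded. That \<open>\<Gamma>\<close> is a
  group at all rests on \<open>stretch_preserves_lattice\<close>: \<open>diag(e\<^sup>\<lambda>, e\<^sup>-\<^sup>\<lambda>)\<close> preserves \<open>P\<int>\<^sup>2\<close> because it is
  conjugate by \<open>P\<close> to a unimodular integer matrix.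

  The differential topology is organised by one notion. A chart of a space \<open>Y\<close> is \<open>adapted\<close> to a map
  \<open>\<pi>\<close> from a Euclidean space onto \<open>Y\<close> if the chart composed with \<open>\<pi>\<close> is smooth and has local smooth
  sections. If two maps \<open>\<pi>\<close> and \<open>\<rho>\<close> from the same Euclidean space satisfy \<open>f \<circ> \<pi> = \<rho>\<close>, then \<open>f\<close>
  is smooth in all adapted charts (\<open>smooth_in_adapted_charts\<close>), because it lifts to the identity. With
  \<open>f = id\<close> this gives the compatibility of charts, and with the comparison of two quotients that have the
  same fibres it gives a diffeomorphism (\<open>diffeomorphic_same_fibres\<close>). So it is enough that the charts of
  the torus are adapted to its projection and that the slice charts of the leaf are adapted to \<open>\<pi> \<circ> j\<close>
  (\<open>slice_chart_adapted\<close>). The leaf is Hausdorff and second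
  countable because the torus is.
\<close>


section \<open>Calculus of smooth maps\<close>

lemma Ck_on_SucE:
  assumes "Ck_on (Suc k) S f"
  obtains f' where "\<And>x. x \<in> S \<Longrightarrow> (f has_derivative f' x) (at x)"
    "\<And>v. Ck_on k S (\<lambda>x. f' x v)"
  using assms that by (simp only: Ck_on.simps) meson

lemma Ck_on_SucI:
  assumes "\<And>x. x \<in> S \<Longrightarrow> (f has_derivative f' x) (at x)"
    and "\<And>v. Ck_on k S (\<lambda>x. f' x v)"
  shows "Ck_on (Suc k) S f"
  using assms by (simp only: Ck_on.simps) blast

lemma Ck_on_cong:
  assumes "open S" "\<And>x. x \<in> S \<Longrightarrow> f x = g x"
  shows "Ck_on k S f \<longleftrightarrow> Ck_on k S g"
proof -
  have *: "Ck_on k S g" if C: "Ck_on k S f" and eq: "\<And>x. x \<in> S \<Longrightarrow> f x = g x"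
    for f g :: "'a \<Rightarrow> 'b"
  proof (cases k)
    case 0
    with C eq show ?thesis by (simp cong: continuous_on_cong)
  next
    case (Suc n)
    obtain f' where f': "\<And>x. x \<in> S \<Longrightarrow> (f has_derivative f' x) (at x)"
      "\<And>v. Ck_on n S (\<lambda>x. f' x v)"
      using C[unfolded Suc] by (rule Ck_on_SucE) (rule that)
    have "(g has_derivative f' x) (at x)" if "x \<in> S" for x
      by (rule has_derivative_transform_within_open[OF f'(1)[OF that] assms(1) that eq])
    then show ?thesis unfolding Suc using f'(2) by (rule Ck_on_SucI)
  qed
  show ?thesis using *[of f g] *[of g f] assms(2) by auto
qed

lemma Ck_on_lower: "Ck_on (Suc k) S f \<Longrightarrow> Ck_on k S f"
proof (induction k arbitrary: f)
  case 0
  then show ?case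
    by (auto intro!: continuous_at_imp_continuous_on dest: has_derivative_continuous)
next
  case (Suc k)
  from Suc.prems obtain f' where f': "\<forall>x\<in>S. (f has_derivative f' x) (at x)"
    "\<And>v. Ck_on (Suc k) S (\<lambda>x. f' x v)"
    by (subst (asm) Ck_on.simps(2)) blast
  show ?case
    unfolding Ck_on.simps(2)[of k] using f'(1) Suc.IH[OF f'(2)] by blast
qed

text \<open>
  Smoothness is a local property although \<^const>\<open>Ck_on\<close> asks for one derivative on all of \<open>S\<close>: the
  Frechet derivative is a global choice with which every local one agrees.
\<close>

lemma Ck_on_local:
  assumes "\<And>x. x \<in> S \<Longrightarrow> \<exists>N. open N \<and> x \<in> N \<and> N \<subseteq> S \<and> Ck_on k N f"
  shows "Ck_on k S f"
  using assms
proof (induction k arbitrary: f)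
  case 0
  show ?case
    unfolding Ck_on.simps
  proof (rule continuous_at_imp_continuous_on, rule ballI)
    fix x assume "x \<in> S"
    then obtain N where "open N" "x \<in> N" "continuous_on N f" using 0 by force
    then show "isCont f x" by (simp add: continuous_on_eq_continuous_at)
  qed
next
  case (Suc k)
  define D where "D x = frechet_derivative f (at x)" for x
  have *: "(f has_derivative D x) (at x) \<and> 
      (\<exists>N. open N \<and> x \<in> N \<and> N \<subseteq> S \<and> (\<forall>v. Ck_on k N (\<lambda>x. D x v)))" if "x \<in> S" for x
  proof -
    obtain N where N: "open N" "x \<in> N" "N \<subseteq> S" "Ck_on (Suc k) N f" using Suc.prems \<open>x \<in> S\<close> by blast
    from N(4) obtain f' where f': "\<And>x. x \<in> N \<Longrightarrow> (f has_derivative f' x) (at x)" "\<And>v. Ck_on k N (\<lambda>x. f' x v)"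
      by (elim Ck_on_SucE) (rule that)
    have eq: "f' y = D y" if "y \<in> N" for y
      unfolding D_def by (rule frechet_derivative_at[OF f'(1)[OF that]])
    have "Ck_on k N (\<lambda>x. D x v)" for v
      using Ck_on_cong[OF N(1), of "\<lambda>x. f' x v" "\<lambda>x. D x v" k] eq f'(2) by auto
    with N eq f'(1)[of x] show ?thesis by auto
  qed
  have "Ck_on k S (\<lambda>x. D x v)" for v
    by (rule Suc.IH) (use * in meson)
  with * show ?case by auto
qed

lemma Ck_on_const: "Ck_on k S (\<lambda>x. c)"
proof (induction k arbitrary: c)
  case (Suc k)
  then show ?case by (auto intro!: exI[of _ "\<lambda>x v. 0"])
qed auto

lemma Ck_on_id: "Ck_on k S (\<lambda>x. x)"
  by (cases k) (auto intro!: exI[of _ "\<lambda>x v. v"] Ck_on_const)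

lemma Ck_on_add:
  assumes "Ck_on k S f" "Ck_on k S g"
  shows "Ck_on k S (\<lambda>x. f x + g x)"
  using assms
proof (induction k arbitrary: f g)
  case 0
  then show ?case by (auto intro: continuous_on_add)
next
  case (Suc k)
  from Suc.prems obtain f' g' where
    f': "\<forall>x\<in>S. (f has_derivative f' x) (at x)" "\<And>v. Ck_on k S (\<lambda>x. f' x v)" and
    g': "\<forall>x\<in>S. (g has_derivative g' x) (at x)" "\<And>v. Ck_on k S (\<lambda>x. g' x v)"
    by auto
  then show ?case using Suc.IH[OF f'(2) g'(2)]
    by (auto intro!: exI[of _ "\<lambda>x v. f' x v + g' x v"] derivative_intros)
qed

lemma Ck_on_sum:
  assumes "\<And>i. i \<in> I \<Longrightarrow> Ck_on k S (f i)"
  shows "Ck_on k S (\<lambda>x. \<Sum>i\<in>I. f i x)"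
  using assms by (induction I rule: infinite_finite_induct) (auto intro: Ck_on_const Ck_on_add)

lemma Ck_on_scaleR:
  fixes f :: "'a::real_normed_vector \<Rightarrow> 'b::real_normed_vector"
  assumes "Ck_on k S a" "Ck_on k S f"
  shows "Ck_on k S (\<lambda>x. a x *\<^sub>R f x)"
  using assms
proof (induction k arbitrary: a f)
  case 0
  then show ?case by (auto intro: continuous_on_scaleR)
next
  case (Suc k)
  from Suc.prems(1) obtain a' where
    a': "\<And>x. x\<in>S \<Longrightarrow> (a has_derivative a' x) (at x)" "\<And>v. Ck_on k S (\<lambda>x. a' x v)"
    by (elim Ck_on_SucE) (rule that)
  from Suc.prems(2) obtain f' where
    f': "\<And>x. x\<in>S \<Longrightarrow> (f has_derivative f' x) (at x)" "\<And>v. Ck_on k S (\<lambda>x. f' x v)"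
    by (elim Ck_on_SucE) (rule that)
  have "Ck_on k S (\<lambda>x. a x *\<^sub>R f' x v + a' x v *\<^sub>R f x)" for v
    by (intro Ck_on_add Suc.IH a'(2) f'(2) Ck_on_lower[OF Suc.prems(1)] Ck_on_lower[OF Suc.prems(2)])
  with a'(1) f'(1) show ?case
    by (intro Ck_on_SucI[OF has_derivative_scaleR]) auto
qed

lemma Ck_on_bounded_linear:
  assumes "bounded_linear T" "Ck_on k S f"
  shows "Ck_on k S (\<lambda>x. T (f x))"
  using assms(2)
proof (induction k arbitrary: f)
  case 0
  then show ?case by (auto intro: bounded_linear.continuous_on[OF assms(1)])
next
  case (Suc k)
  then obtain f' where
    f': "\<forall>x\<in>S. (f has_derivative f' x) (at x)" "\<And>v. Ck_on k S (\<lambda>x. f' x v)"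
    by auto
  then show ?case using Suc.IH[OF f'(2)]
    by (auto intro!: exI[of _ "\<lambda>x v. T (f' x v)"] bounded_linear.has_derivative[OF assms(1)])
qed

text \<open>
  The derivative of the composition is \<open>x \<mapsto> g'(f x)(f' x v)\<close>, where the argument of \<open>g'(f x)\<close> varies with
  \<open>x\<close>. Expanding this argument in a basis leaves only directional derivatives of \<open>g\<close> in fixed directions,
  to which the induction hypothesis applies; this is why the intermediate space is Euclidean.
\<close>

lemma Ck_on_compose:
  fixes f :: "'a::real_normed_vector \<Rightarrow> 'b::euclidean_space"
    and g :: "'b \<Rightarrow> 'c::real_normed_vector"
  assumes "Ck_on k S f" "Ck_on k T g" "f ` S \<subseteq> T"
  shows "Ck_on k S (g \<circ> f)"
  using assms
proof (induction k arbitrary: g)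
  case 0
  then show ?case
    using continuous_on_compose continuous_on_subset by (metis Ck_on.simps(1))
next
  case (Suc k)
  from Suc.prems(1) obtain f' where
    f': "\<And>x. x\<in>S \<Longrightarrow> (f has_derivative f' x) (at x)" "\<And>v. Ck_on k S (\<lambda>x. f' x v)"
    by (elim Ck_on_SucE) (rule that)
  from Suc.prems(2) obtain g' where
    g': "\<And>x. x\<in>T \<Longrightarrow> (g has_derivative g' x) (at x)" "\<And>v. Ck_on k T (\<lambda>x. g' x v)"
    by (elim Ck_on_SucE) (rule that)
  have expand: "g' y w = (\<Sum>b\<in>Basis. (w \<bullet> b) *\<^sub>R g' y b)" if "y \<in> T" for y w
  proof -
    interpret bounded_linear "g' y" using g'(1)[OF that] by (rule has_derivative_bounded_linear)
    have "g' y w = g' y (\<Sum>b\<in>Basis. (w \<bullet> b) *\<^sub>R b)" by (simp add: euclidean_representation)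
    then show ?thesis by (simp add: sum scale)
  qed
  have "Ck_on k S (\<lambda>x. \<Sum>b\<in>Basis. (f' x v \<bullet> b) *\<^sub>R g' (f x) b)" for v
  proof (intro Ck_on_sum Ck_on_scaleR)
    fix b :: 'b
    show "Ck_on k S (\<lambda>x. f' x v \<bullet> b)"
      by (rule Ck_on_bounded_linear[OF bounded_linear_inner_left f'(2)])
    show "Ck_on k S (\<lambda>x. g' (f x) b)"
      using Suc.IH[OF Ck_on_lower[OF Suc.prems(1)] g'(2) Suc.prems(3), of b] by (simp add: o_def)
  qed
  moreover have "(g \<circ> f has_derivative (\<lambda>v. \<Sum>b\<in>Basis. (f' x v \<bullet> b) *\<^sub>R g' (f x) b)) (at x)" 
    if "x \<in> S" for x
  proof -
    have "f x \<in> T" using that Suc.prems(3) by auto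
    then show ?thesis
      using diff_chain_at[OF f'(1)[OF that] g'(1)] by (simp add: o_def flip: expand)
  qed
  ultimately show ?case by (intro Ck_on_SucI)
qed

lemma smooth_on_imp_continuous_on: "smooth_on S f \<Longrightarrow> continuous_on S f"
  unfolding smooth_on_def using Ck_on.simps(1) by blast

lemma smooth_on_compose:
  fixes f :: "'a::real_normed_vector \<Rightarrow> 'b::euclidean_space"
  assumes "smooth_on S f" "smooth_on T g" "f ` S \<subseteq> T"
  shows "smooth_on S (g \<circ> f)"
  using assms Ck_on_compose unfolding smooth_on_def by blast

lemma smooth_on_subset:
  assumes "smooth_on S f" "T \<subseteq> S"
  shows "smooth_on T f"
proof -
  have "Ck_on k S f \<Longrightarrow> Ck_on k T f" for k
  proof (induction k arbitrary: f)
    case 0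
    then show ?case using assms(2) continuous_on_subset by auto
  next
    case (Suc k)
    then obtain f' where "\<And>x. x\<in>S \<Longrightarrow> (f has_derivative f' x) (at x)" "\<And>v. Ck_on k S (\<lambda>x. f' x v)"
      by (elim Ck_on_SucE) (rule that)
    then show ?case using Suc.IH assms(2) by (intro Ck_on_SucI) auto
  qed
  then show ?thesis using assms(1) by (simp add: smooth_on_def)
qed

lemma smooth_on_id: "smooth_on S (\<lambda>x. x)"
  unfolding smooth_on_def using Ck_on_id by blast

lemma smooth_on_const: "smooth_on S (\<lambda>x. c)"
  unfolding smooth_on_def using Ck_on_const by blast

lemma smooth_on_add: "smooth_on S f \<Longrightarrow> smooth_on S g \<Longrightarrow> smooth_on S (\<lambda>x. f x + g x)"
  unfolding smooth_on_def using Ck_on_add by blast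

lemma smooth_on_bounded_linear: "bounded_linear T \<Longrightarrow> smooth_on S T"
  unfolding smooth_on_def using Ck_on_bounded_linear[OF _ Ck_on_id] by blast

lemma smooth_on_locally:
  assumes "\<And>x. x \<in> S \<Longrightarrow>
    \<exists>N g. open N \<and> x \<in> N \<and> N \<subseteq> S \<and> smooth_on N g \<and> (\<forall>y\<in>N. f y = g y)"
  shows "smooth_on S f"
  unfolding smooth_on_def
proof (intro allI Ck_on_local)
  fix k x assume "x \<in> S"
  then obtain N g where N: "open N" "x \<in> N" "N \<subseteq> S" "smooth_on N g" "\<forall>y\<in>N. f y = g y"
    using assms by blast
  then have "Ck_on k N f" using Ck_on_cong[OF N(1), of f g k] by (simp add: smooth_on_def)
  with N show "\<exists>N. open N \<and> x \<in> N \<and> N \<subseteq> S \<and> Ck_on k N f" by blast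
qed


section \<open>Charts adapted to a projection\<close>

text \<open>
  The last clause makes \<open>\<phi> \<circ> \<pi>\<close> a smooth submersion onto \<open>\<phi> ` U\<close>, expressed through local smooth
  sections, which avoids any rank condition.
\<close>

definition adapted_chart :: "('k::euclidean_space \<Rightarrow> 'a) \<Rightarrow> ('a, 'e::euclidean_space) chart \<Rightarrow> bool" where
  "adapted_chart \<pi> = (\<lambda>(U, \<phi>). inj_on \<phi> U \<and> open (\<pi> -` U) \<and> smooth_on (\<pi> -` U) (\<phi> \<circ> \<pi>) \<and>
     (\<forall>y\<in>\<phi> ` U. \<exists>N s. open N \<and> y \<in> N \<and> smooth_on N s \<and>
        (\<forall>z\<in>N. \<pi> (s z) \<in> U \<and> \<phi> (\<pi> (s z)) = z)))"

lemma adapted_chartE: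
  assumes "adapted_chart \<pi> (U, \<phi>)" "y \<in> \<phi> ` U"
  obtains N s where "open N" "y \<in> N" "N \<subseteq> \<phi> ` U" "smooth_on N s"
    "\<And>z. z \<in> N \<Longrightarrow> \<pi> (s z) = the_inv_into U \<phi> z"
proof -
  obtain N s where N: "open N" "y \<in> N" "smooth_on N s" "\<forall>z\<in>N. \<pi> (s z) \<in> U \<and> \<phi> (\<pi> (s z)) = z"
    using assms unfolding adapted_chart_def split by meson
  have inj: "inj_on \<phi> U" using assms(1) by (simp add: adapted_chart_def)
  have "N \<subseteq> \<phi> ` U" using N(4) by (metis image_eqI subsetI)
  moreover have "\<pi> (s z) = the_inv_into U \<phi> z" if "z \<in> N" for z
    using N(4) the_inv_into_f_f[OF inj, of "\<pi> (s z)"] that by simp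
  ultimately show thesis using N that by blast
qed

text \<open>
  Precomposing the coordinate expression \<open>\<psi> \<circ> f \<circ> \<phi>\<^sup>-\<^sup>1\<close> with \<open>\<phi> \<circ> \<pi>\<close> yields the smooth map \<open>\<psi> \<circ> \<rho>\<close>. So locally
  the expression itself is \<open>\<psi> \<circ> \<rho>\<close> after a smooth section of \<open>\<phi> \<circ> \<pi>\<close>. Compatibility of
  charts and smoothness of maps between manifolds are deduced from this lemma throughout.
\<close>

lemma smooth_in_adapted_charts:
  fixes \<pi> :: "'k::euclidean_space \<Rightarrow> 'a" and \<rho> :: "'k \<Rightarrow> 'b"
  assumes c: "adapted_chart \<pi> c" and d: "adapted_chart \<rho> d" and f: "\<And>x. f (\<pi> x) = \<rho> x"
  shows "smooth_in_charts c d f"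
proof -
  obtain U \<phi> V \<psi> where [simp]: "c = (U, \<phi>)" "d = (V, \<psi>)" by fastforce
  have inj: "inj_on \<phi> U" using c by (simp add: adapted_chart_def)
  have V: "open (\<rho> -` V)" "smooth_on (\<rho> -` V) (\<psi> \<circ> \<rho>)"
    using d by (simp_all add: adapted_chart_def)
  have "smooth_on (\<phi> ` (U \<inter> f -` V)) (\<psi> \<circ> f \<circ> the_inv_into U \<phi>)"
  proof (rule smooth_on_locally)
    fix y assume y: "y \<in> \<phi> ` (U \<inter> f -` V)"
    then have yU: "y \<in> \<phi> ` U" by auto
    obtain N s where N: "open N" "y \<in> N" "N \<subseteq> \<phi> ` U" "smooth_on N s"
      and s: "\<And>z. z \<in> N \<Longrightarrow> \<pi> (s z) = the_inv_into U \<phi> z"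
      using adapted_chartE[OF c[simplified] yU] by metis
    define N' where "N' = N \<inter> s -` (\<rho> -` V)"
    have \<rho>s: "\<rho> (s z) = f (the_inv_into U \<phi> z)" if "z \<in> N" for z
      using f[of "s z"] s[OF that] by simp
    have "open N'"
      unfolding N'_def using smooth_on_imp_continuous_on[OF N(4)] N(1) V(1)
      by (rule continuous_open_preimage)
    moreover have "y \<in> N'"
    proof -
      obtain p where p: "p \<in> U" "f p \<in> V" "y = \<phi> p" using y by auto
      then have "the_inv_into U \<phi> y = p" using the_inv_into_f_f[OF inj] by simp
      with p N \<rho>s[of y] show ?thesis by (simp add: N'_def)
    qed
    moreover have "N' \<subseteq> \<phi> ` (U \<inter> f -` V)"
    proof
      fix z assume z: "z \<in> N'"
      then have "z \<in> N" "f (the_inv_into U \<phi> z) \<in> V" using \<rho>s by (auto simp: N'_def)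
      moreover from this have "z \<in> \<phi> ` U" using N by auto
      ultimately show "z \<in> \<phi> ` (U \<inter> f -` V)"
        using the_inv_into_into[OF inj _ order_refl] f_the_inv_into_f[OF inj]
        by (intro image_eqI[of _ _ "the_inv_into U \<phi> z"]) simp_all
    qed
    moreover have "smooth_on N' ((\<psi> \<circ> \<rho>) \<circ> s)"
    proof (rule smooth_on_compose[OF _ V(2)])
      show "smooth_on N' s" using N(4) by (rule smooth_on_subset) (auto simp: N'_def)
    qed (auto simp: N'_def)
    ultimately show "\<exists>N g. open N \<and> y \<in> N \<and> N \<subseteq> \<phi> ` (U \<inter> f -` V) \<and> smooth_on N g \<and>
        (\<forall>z\<in>N. (\<psi> \<circ> f \<circ> the_inv_into U \<phi>) z = g z)"
      using \<rho>s by (intro exI[of _ N'] exI[of _ "(\<psi> \<circ> \<rho>) \<circ> s"]) (auto simp: N'_def)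
  qed
  then show ?thesis by (simp add: smooth_in_charts_def)
qed

lemma topspace_quotient_topology: "topspace (quotient_topology \<pi>) = range \<pi>"
proof (rule subset_antisym)
  show "topspace (quotient_topology \<pi>) \<subseteq> range \<pi>"
    using openin_topspace[of "quotient_topology \<pi>"] unfolding openin_quotient_topology by blast
  show "range \<pi> \<subseteq> topspace (quotient_topology \<pi>)"
  proof (rule openin_subset)
    have "\<pi> -` range \<pi> = UNIV" by auto
    then show "openin (quotient_topology \<pi>) (range \<pi>)" by (simp add: openin_quotient_topology)
  qed
qed

text \<open>
  Continuity of the chart is the continuity of \<open>\<phi> \<circ> \<pi>\<close>, by the definition of the quotient topology;
  the sections give that it is open.
\<close>

lemma adapted_chart_is_chart:
  fixes \<pi> :: "'k::euclidean_space \<Rightarrow> 'a" and c :: "('a, 'c::euclidean_space) chart"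
  assumes c: "adapted_chart \<pi> c" and "fst c \<subseteq> range \<pi>"
  shows "is_chart (quotient_topology \<pi>) c"
proof -
  obtain U \<phi> where [simp]: "c = (U, \<phi>)" by fastforce
  have U: "U \<subseteq> range \<pi>" using assms by simp
  have inj: "inj_on \<phi> U" and oU: "open (\<pi> -` U)" and sm: "smooth_on (\<pi> -` U) (\<phi> \<circ> \<pi>)"
    using c by (simp_all add: adapted_chart_def)
  have top: "openin (quotient_topology \<pi>) U" using U oU by (simp add: openin_quotient_topology)
  have openim: "open (\<phi> ` V)" if V: "openin (quotient_topology \<pi>) V" "V \<subseteq> U" for V
  proof (subst open_subopen, rule ballI)
    fix y assume y: "y \<in> \<phi> ` V"
    then have "y \<in> \<phi> ` U" using V by auto
    then obtain N s where N: "open N" "y \<in> N" "N \<subseteq> \<phi> ` U" "smooth_on N s"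
      and s: "\<And>z. z \<in> N \<Longrightarrow> \<pi> (s z) = the_inv_into U \<phi> z"
      using adapted_chartE[OF c[simplified]] by metis
    have "open (N \<inter> s -` (\<pi> -` V))"
      using smooth_on_imp_continuous_on[OF N(4)] N(1)
      by (rule continuous_open_preimage) (use V(1) in \<open>simp add: openin_quotient_topology\<close>)
    moreover obtain p where p: "p \<in> V" "y = \<phi> p" using y by auto
    then have "y \<in> N \<inter> s -` (\<pi> -` V)"
      using p V(2) s[of y] N(2) the_inv_into_f_f[OF inj, of p] by auto
    moreover have "N \<inter> s -` (\<pi> -` V) \<subseteq> \<phi> ` V"
    proof
      fix z assume z: "z \<in> N \<inter> s -` (\<pi> -` V)"
      then have "the_inv_into U \<phi> z \<in> V" using s by auto
      moreover have "\<phi> (the_inv_into U \<phi> z) = z" using z N(3) f_the_inv_into_f[OF inj] by auto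
      ultimately show "z \<in> \<phi> ` V" by (metis image_eqI)
    qed
    ultimately show "\<exists>T. open T \<and> y \<in> T \<and> T \<subseteq> \<phi> ` V" by blast
  qed
  have cont: "continuous_map (subtopology (quotient_topology \<pi>) U) (top_of_set (\<phi> ` U)) \<phi>"
    unfolding continuous_map_in_subtopology
  proof
    show "continuous_map (subtopology (quotient_topology \<pi>) U) euclidean \<phi>"
      unfolding continuous_map_def
    proof (intro conjI allI impI)
      fix T :: "'c set" assume "openin euclidean T"
      then have "open ((\<pi> -` U) \<inter> (\<phi> \<circ> \<pi>) -` T)"
        using continuous_open_preimage[OF smooth_on_imp_continuous_on[OF sm] oU] by simp
      moreover have "(\<pi> -` U) \<inter> (\<phi> \<circ> \<pi>) -` T = \<pi> -` (U \<inter> \<phi> -` T)" by auto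
      ultimately have "openin (quotient_topology \<pi>) (U \<inter> \<phi> -` T)"
        using U by (auto simp: openin_quotient_topology)
      moreover have "{x \<in> topspace (subtopology (quotient_topology \<pi>) U). \<phi> x \<in> T} = (U \<inter> \<phi> -` T) \<inter> U"
        using U by (auto simp: topspace_quotient_topology)
      ultimately show "openin (subtopology (quotient_topology \<pi>) U)
          {x \<in> topspace (subtopology (quotient_topology \<pi>) U). \<phi> x \<in> T}"
        by (metis openin_subtopology)
    qed auto
    show "\<phi> \<in> topspace (subtopology (quotient_topology \<pi>) U) \<rightarrow> \<phi> ` U" by auto
  qed
  have "homeomorphic_map (subtopology (quotient_topology \<pi>) U) (top_of_set (\<phi> ` U)) \<phi>"
  proof (rule bijective_open_imp_homeomorphic_map[OF cont])
    show "open_map (subtopology (quotient_topology \<pi>) U) (top_of_set (\<phi> ` U)) \<phi>"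
      unfolding open_map_def
    proof (intro allI impI)
      fix V assume V: "openin (subtopology (quotient_topology \<pi>) U) V"
      then have "openin (quotient_topology \<pi>) V" "V \<subseteq> U"
        by (simp_all add: openin_open_subtopology[OF top])
      then show "openin (top_of_set (\<phi> ` U)) (\<phi> ` V)"
        using openim by (intro open_subset image_mono)
    qed
  qed (use U inj in \<open>simp_all add: topspace_quotient_topology inf.absorb2\<close>)
  with top openim[OF top order_refl] show ?thesis by (simp add: is_chart_def)
qed

lemma smooth_manifold_quotient:
  assumes "Hausdorff_space (quotient_topology \<pi>)" "second_countable (quotient_topology \<pi>)"
    and A: "\<And>c. c \<in> \<A> \<Longrightarrow> adapted_chart \<pi> c" and cov: "(\<Union>c\<in>\<A>. fst c) = range \<pi>"
  shows "smooth_manifold (quotient_topology \<pi>, \<A>)"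
proof -
  have "is_chart (quotient_topology \<pi>) c" if "c \<in> \<A>" for c
    using adapted_chart_is_chart[OF A[OF that]] cov that by blast
  moreover have "compatible_charts c d" if "c \<in> \<A>" "d \<in> \<A>" for c d
    unfolding compatible_charts_def
    by (auto intro!: smooth_in_adapted_charts[OF A A] that)
  ultimately show ?thesis
    using assms by (auto simp: smooth_manifold_def topspace_quotient_topology)
qed

text \<open>
  The two spaces are quotients of the same Euclidean space by the same equivalence relation, so the
  topological axioms need to be known for one of them only.
\<close>

lemma diffeomorphic_same_fibres:
  fixes \<pi> :: "'k::euclidean_space \<Rightarrow> 'a" and \<rho> :: "'k \<Rightarrow> 'b"
  assumes fib: "\<And>x y. \<pi> x = \<pi> y \<longleftrightarrow> \<rho> x = \<rho> y"
    and A: "\<And>c. c \<in> \<A> \<Longrightarrow> adapted_chart \<pi> c" and covA: "(\<Union>c\<in>\<A>. fst c) = range \<pi>"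
    and B: "\<And>c. c \<in> \<B> \<Longrightarrow> adapted_chart \<rho> c" and covB: "(\<Union>c\<in>\<B>. fst c) = range \<rho>"
    and "Hausdorff_space (quotient_topology \<rho>)" "second_countable (quotient_topology \<rho>)"
  shows "diffeomorphic (quotient_topology \<pi>, \<A>) (quotient_topology \<rho>, \<B>)"
proof -
  define f where "f p = \<rho> (inv_into UNIV \<pi> p)" for p
  define g where "g p = \<pi> (inv_into UNIV \<rho> p)" for p
  have f: "f (\<pi> x) = \<rho> x" for x
    unfolding f_def using fib f_inv_into_f[of "\<pi> x" \<pi> UNIV] by blast
  have g: "g (\<rho> x) = \<pi> x" for x
    unfolding g_def using fib f_inv_into_f[of "\<rho> x" \<rho> UNIV] by blast
  have cont: "continuous_map (quotient_topology \<pi>) (quotient_topology \<rho>) f"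
    if f: "\<And>x. f (\<pi> x) = \<rho> x" for f and \<pi> :: "'k \<Rightarrow> 'x" and \<rho> :: "'k \<Rightarrow> 'y"
    unfolding continuous_map_def
  proof (intro conjI allI impI)
    fix U assume "openin (quotient_topology \<rho>) U"
    moreover have "\<pi> -` {p \<in> topspace (quotient_topology \<pi>). f p \<in> U} = \<rho> -` U"
      using f by (auto simp: topspace_quotient_topology)
    ultimately show "openin (quotient_topology \<pi>) {p \<in> topspace (quotient_topology \<pi>). f p \<in> U}"
      by (auto simp: openin_quotient_topology topspace_quotient_topology)
  qed (auto simp: topspace_quotient_topology f)
  have "homeomorphic_maps (quotient_topology \<pi>) (quotient_topology \<rho>) f g"
    unfolding homeomorphic_maps_def using cont[of f \<pi> \<rho>, OF f] cont[of g \<rho> \<pi>, OF g]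
    by (auto simp: topspace_quotient_topology f g)
  then have "quotient_topology \<pi> homeomorphic_space quotient_topology \<rho>"
    unfolding homeomorphic_space_def by blast
  with assms(6,7) have "Hausdorff_space (quotient_topology \<pi>)" "second_countable (quotient_topology \<pi>)"
    using homeomorphic_Hausdorff_space homeomorphic_space_second_countability by blast+
  then have "smooth_manifold (quotient_topology \<pi>, \<A>)"
    using A covA by (rule smooth_manifold_quotient)
  moreover have "smooth_manifold (quotient_topology \<rho>, \<B>)"
    using assms(6,7) B covB by (rule smooth_manifold_quotient)
  moreover have "smooth_map (quotient_topology \<pi>, \<A>) (quotient_topology \<rho>, \<B>) f"
    using cont[of f \<pi> \<rho>, OF f] smooth_in_adapted_charts[OF A B f] by (simp add: smooth_map_def)
  moreover have "smooth_map (quotient_topology \<rho>, \<B>) (quotient_topology \<pi>, \<A>) g"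
    using cont[of g \<rho> \<pi>, OF g] smooth_in_adapted_charts[OF B A g] by (simp add: smooth_map_def)
  ultimately show ?thesis
    unfolding diffeomorphic_def diffeomorphism_def
    by (intro conjI exI[of _ f] exI[of _ g]) (auto simp: topspace_quotient_topology f g)
qed


section \<open>Quotients whose fibres are related by smooth maps\<close>

text \<open>
  All that is used of a group acting on the domain of \<open>\<pi>\<close> with the fibres of \<open>\<pi>\<close> as orbits. The maps \<open>g\<close>
  are the deck transformations.
\<close>

definition smooth_deck :: "('e::euclidean_space \<Rightarrow> 'a) \<Rightarrow> bool" where
  "smooth_deck \<pi> \<longleftrightarrow> (\<forall>x y. \<pi> x = \<pi> y \<longrightarrow>
     (\<exists>g. smooth_on UNIV g \<and> g x = y \<and> (\<forall>z. \<pi> (g z) = \<pi> z)))"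

lemma smooth_deckE:
  assumes "smooth_deck \<pi>" "\<pi> x = \<pi> y"
  obtains g where "smooth_on UNIV g" "g x = y" "\<And>z. \<pi> (g z) = \<pi> z"
  using assms unfolding smooth_deck_def by metis

text \<open>
  A deck transformation carries a neighbourhood of \<open>x\<close> into \<open>W\<close> without changing the images under
  \<open>\<pi>\<close>. It serves both to show that \<open>\<pi>\<close> is open and to compute the chart \<open>(\<pi>|W)\<^sup>-\<^sup>1\<close> away from \<open>W\<close>.
\<close>

lemma smooth_deck_translates:
  assumes \<pi>: "smooth_deck \<pi>" and "\<pi> x \<in> \<pi> ` W" and W: "open W"
  obtains g N where "open N" "x \<in> N" "smooth_on N g" "g ` N \<subseteq> W" "\<And>z. \<pi> (g z) = \<pi> z"
proof -
  obtain w where w: "w \<in> W" "\<pi> x = \<pi> w" using assms(2) by auto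
  obtain g where g: "smooth_on UNIV g" "g x = w" "\<And>z. \<pi> (g z) = \<pi> z"
    using smooth_deckE[OF \<pi> w(2)] by metis
  show thesis
  proof
    show "open (g -` W)"
      using continuous_open_preimage[OF smooth_on_imp_continuous_on[OF g(1)] open_UNIV W] by simp
    show "smooth_on (g -` W) g" using g(1) smooth_on_subset by blast
  qed (use g w in auto)
qed

lemma smooth_deck_open_saturation:
  assumes \<pi>: "smooth_deck \<pi>" and "open W"
  shows "open (\<pi> -` (\<pi> ` W))"
proof (subst open_subopen, rule ballI)
  fix x assume "x \<in> \<pi> -` (\<pi> ` W)"
  then have "\<pi> x \<in> \<pi> ` W" by simp
  then obtain g N where N: "open N" "x \<in> N" "smooth_on N g" "g ` N \<subseteq> W" and g: "\<And>z. \<pi> (g z) = \<pi> z"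
    by (rule smooth_deck_translates[OF \<pi> _ \<open>open W\<close>]) (rule that)
  have "N \<subseteq> \<pi> -` (\<pi> ` W)"
  proof
    fix z assume "z \<in> N"
    then have "\<pi> (g z) \<in> \<pi> ` W" using N(4) by blast
    then show "z \<in> \<pi> -` (\<pi> ` W)" using g by simp
  qed
  with N show "\<exists>T. open T \<and> x \<in> T \<and> T \<subseteq> \<pi> -` (\<pi> ` W)" by blast
qed

lemma openin_quotient_image:
  assumes "smooth_deck \<pi>" "open W"
  shows "openin (quotient_topology \<pi>) (\<pi> ` W)"
  using smooth_deck_open_saturation[OF assms] by (auto simp: openin_quotient_topology)

lemma second_countable_quotient:
  fixes \<pi> :: "'a::euclidean_space \<Rightarrow> 'b"
  assumes "smooth_deck \<pi>"
  shows "second_countable (quotient_topology \<pi>)"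
proof (rule second_countable_open_map_image[of euclidean _ \<pi>])
  show "continuous_map euclidean (quotient_topology \<pi>) \<pi>"
    unfolding continuous_map_def
    by (auto simp: topspace_quotient_topology openin_quotient_topology vimage_def)
  show "open_map euclidean (quotient_topology \<pi>) \<pi>"
    unfolding open_map_def using openin_quotient_image[OF assms] by simp
  show "second_countable (euclidean :: 'a topology)"
  proof -
    obtain B :: "'a set set" where B: "countable B" "topological_basis B"
      using ex_countable_basis by blast
    have "\<exists>V\<in>B. x \<in> V \<and> V \<subseteq> U" if "open U" "x \<in> U" for U x
      using topological_basisE[OF B(2) that] by metis
    then show ?thesis
      unfolding second_countable_def open_openin[symmetric]
      using B topological_basis_open[OF B(2)] by (intro exI[of _ B]) blast
  qed
qed (auto simp: topspace_quotient_topology)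

text \<open>
  Near a point of \<open>\<pi>\<^sup>-\<^sup>1(\<pi>(W))\<close> the map \<open>(\<pi>|W)\<^sup>-\<^sup>1 \<circ> \<pi>\<close> is a deck transformation into \<open>W\<close>, and the identity of
  \<open>W\<close> is a section of it.
\<close>

lemma quotient_chart_adapted:
  fixes \<pi> :: "'e::euclidean_space \<Rightarrow> 'a"
  assumes \<pi>: "smooth_deck \<pi>" and W: "open W" "inj_on \<pi> W"
  shows "adapted_chart \<pi> (\<pi> ` W, the_inv_into W \<pi>)"
proof -
  have inv: "the_inv_into W \<pi> (\<pi> w) = w" if "w \<in> W" for w
    using the_inv_into_f_f[OF W(2) that] .
  have "smooth_on (\<pi> -` \<pi> ` W) (the_inv_into W \<pi> \<circ> \<pi>)"
  proof (rule smooth_on_locally)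
    fix x assume "x \<in> \<pi> -` \<pi> ` W"
    then have "\<pi> x \<in> \<pi> ` W" by simp
    then obtain g N where N: "open N" "x \<in> N" "smooth_on N g" "g ` N \<subseteq> W" and g: "\<And>z. \<pi> (g z) = \<pi> z"
      by (rule smooth_deck_translates[OF \<pi> _ W(1)]) (rule that)
    have "(the_inv_into W \<pi> \<circ> \<pi>) z = g z \<and> z \<in> \<pi> -` \<pi> ` W" if "z \<in> N" for z
    proof -
      have gz: "g z \<in> W" using N(4) that by blast
      then show ?thesis using inv[OF gz] g[of z] by (metis comp_apply image_eqI vimageI2)
    qed
    then show "\<exists>N g. open N \<and> x \<in> N \<and> N \<subseteq> \<pi> -` \<pi> ` W \<and> smooth_on N g \<and>
        (\<forall>z\<in>N. (the_inv_into W \<pi> \<circ> \<pi>) z = g z)"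
      using N by (intro exI[of _ N] exI[of _ g]) auto
  qed
  moreover have im: "the_inv_into W \<pi> ` \<pi> ` W = W" using inv by force
  moreover have "\<exists>N s. open N \<and> y \<in> N \<and> smooth_on N s \<and>
      (\<forall>z\<in>N. \<pi> (s z) \<in> \<pi> ` W \<and> the_inv_into W \<pi> (\<pi> (s z)) = z)" if "y \<in> W" for y
    using W that inv smooth_on_id by (intro exI[of _ W] exI[of _ "\<lambda>x. x"]) auto
  ultimately show ?thesis
    using inj_on_the_inv_into[OF W(2)] smooth_deck_open_saturation[OF \<pi> W(1)]
    unfolding adapted_chart_def split im by blast
qed

definition locally_injective :: "('e::topological_space \<Rightarrow> 'a) \<Rightarrow> bool" where
  "locally_injective \<pi> \<longleftrightarrow> (\<forall>x. \<exists>W. open W \<and> x \<in> W \<and> inj_on \<pi> W)"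

lemma quotient_charts_cover:
  assumes "locally_injective \<pi>"
  shows "(\<Union>c\<in>snd (quotient_manifold \<pi>). fst c) = range \<pi>"
proof
  show "range \<pi> \<subseteq> (\<Union>c\<in>snd (quotient_manifold \<pi>). fst c)"
  proof
    fix p assume "p \<in> range \<pi>"
    then obtain x W where "p = \<pi> x" "open W" "x \<in> W" "inj_on \<pi> W"
      using assms unfolding locally_injective_def by blast
    then show "p \<in> (\<Union>c\<in>snd (quotient_manifold \<pi>). fst c)"
      by (auto simp: quotient_manifold_def)
  qed
qed (auto simp: quotient_manifold_def)

lemma quotient_manifold_adapted:
  assumes "smooth_deck \<pi>" "c \<in> snd (quotient_manifold \<pi>)"
  shows "adapted_chart \<pi> c"
  using assms quotient_chart_adapted by (auto simp: quotient_manifold_def)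

text \<open>
  A local inverse of \<open>\<pi>\<close> is a chart, so compatibility with it in the two directions says that \<open>\<phi> \<circ> \<pi>\<close> is
  smooth near the given point and that it has a smooth section.
\<close>

lemma maximal_atlas_adapted:
  fixes \<pi> :: "'e::euclidean_space \<Rightarrow> 'a"
  assumes \<pi>: "smooth_deck \<pi>" "locally_injective \<pi>" and c: "c \<in> maximal_atlas (quotient_manifold \<pi>)"
  shows "adapted_chart \<pi> c"
proof -
  obtain U \<phi> where [simp]: "c = (U, \<phi>)" by fastforce
  have chart: "is_chart (quotient_topology \<pi>) (U, \<phi>)"
    and comp: "\<And>W. open W \<Longrightarrow> inj_on \<pi> W \<Longrightarrow> compatible_charts (U, \<phi>) (\<pi> ` W, the_inv_into W \<pi>)"
    using c by (auto simp: maximal_atlas_def quotient_manifold_def)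
  have U: "openin (quotient_topology \<pi>) U" "open (\<phi> ` U)"
    and hom: "homeomorphic_map (subtopology (quotient_topology \<pi>) U) (top_of_set (\<phi> ` U)) \<phi>"
    using chart by (simp_all add: is_chart_def)
  have U\<pi>: "U \<subseteq> range \<pi>" "open (\<pi> -` U)" using U(1) by (simp_all add: openin_quotient_topology)
  have inj: "inj_on \<phi> U"
    using homeomorphic_imp_injective_map[OF hom] U\<pi>(1) by (simp add: topspace_quotient_topology inf.absorb2)
  have openim: "open (\<phi> ` (U \<inter> V))" if "openin (quotient_topology \<pi>) V" for V
  proof -
    have "openin (subtopology (quotient_topology \<pi>) U) (U \<inter> V)"
      using that by (metis inf_commute openin_subtopology)
    then have "openin (top_of_set (\<phi> ` U)) (\<phi> ` (U \<inter> V))"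
      using homeomorphic_imp_open_map[OF hom] unfolding open_map_def by blast
    then show ?thesis using U(2) openin_open_trans by blast
  qed
  have "smooth_on (\<pi> -` U) (\<phi> \<circ> \<pi>)"
  proof (rule smooth_on_locally)
    fix x assume x: "x \<in> \<pi> -` U"
    obtain W where W: "open W" "x \<in> W" "inj_on \<pi> W"
      using \<pi>(2) unfolding locally_injective_def by blast
    have inv: "the_inv_into W \<pi> (\<pi> w) = w" if "w \<in> W" for w
      using the_inv_into_f_f[OF W(3) that] .
    have invinv: "the_inv_into (\<pi> ` W) (the_inv_into W \<pi>) w = \<pi> w" if "w \<in> W" for w
      using the_inv_into_f_f[OF inj_on_the_inv_into[OF W(3)], of "\<pi> w"] inv[OF that] that by simp
    have "the_inv_into W \<pi> ` (\<pi> ` W \<inter> U) = W \<inter> \<pi> -` U"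
    proof (intro equalityI subsetI)
      fix z assume "z \<in> W \<inter> \<pi> -` U"
      then show "z \<in> the_inv_into W \<pi> ` (\<pi> ` W \<inter> U)"
        using inv[of z] by (intro image_eqI[of _ _ "\<pi> z"]) auto
    qed (use inv in auto)
    then have "smooth_on (W \<inter> \<pi> -` U) (\<phi> \<circ> id \<circ> the_inv_into (\<pi> ` W) (the_inv_into W \<pi>))"
      using comp[OF W(1,3)] by (simp add: compatible_charts_def smooth_in_charts_def)
    then show "\<exists>N g. open N \<and> x \<in> N \<and> N \<subseteq> \<pi> -` U \<and> smooth_on N g \<and> (\<forall>z\<in>N. (\<phi> \<circ> \<pi>) z = g z)"
      using W x U\<pi>(2) invinv
      by (intro exI[of _ "W \<inter> \<pi> -` U"] exI[of _ "\<phi> \<circ> id \<circ> the_inv_into (\<pi> ` W) (the_inv_into W \<pi>)"]) auto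
  qed
  moreover have "\<exists>N s. open N \<and> y \<in> N \<and> smooth_on N s \<and>
        (\<forall>z\<in>N. \<pi> (s z) \<in> U \<and> \<phi> (\<pi> (s z)) = z)" if "y \<in> \<phi> ` U" for y
  proof -
    obtain p where p: "p \<in> U" "y = \<phi> p" using \<open>y \<in> \<phi> ` U\<close> by auto
    then obtain x where "p = \<pi> x" using U\<pi>(1) by auto
    with p have x: "\<pi> x \<in> U" "y = \<phi> (\<pi> x)" by auto
    obtain W where W: "open W" "x \<in> W" "inj_on \<pi> W"
      using \<pi>(2) unfolding locally_injective_def by blast
    \<comment> \<open>the section is the transition map from \<open>\<phi>\<close> to the local inverse of \<open>\<pi>\<close>\<close>
    let ?N = "\<phi> ` (U \<inter> \<pi> ` W)"
    let ?s = "the_inv_into W \<pi> \<circ> id \<circ> the_inv_into U \<phi>"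
    have "smooth_on ?N ?s"
      using comp[OF W(1,3)] by (simp add: compatible_charts_def smooth_in_charts_def)
    moreover have "\<pi> (?s z) \<in> U \<and> \<phi> (\<pi> (?s z)) = z" if "z \<in> ?N" for z
      using that the_inv_into_f_f[OF inj] f_the_inv_into_f[OF W(3)] by auto
    ultimately show ?thesis
      using x W openim[OF openin_quotient_image[OF \<pi>(1) W(1)]]
      by (intro exI[of _ ?N] exI[of _ ?s]) blast
  qed
  ultimately show ?thesis using inj U\<pi>(2) by (simp add: adapted_chart_def)
qed


section \<open>Submanifolds that are images of affine subspaces\<close>

text \<open>
  A slice chart identifies the affine subspace with the model space by a linear map; this inverse allows
  sections over the ambient space to be restricted to the slice.
\<close>

lemma linear_bij_affine_inverse:
  fixes h :: "'e::euclidean_space \<Rightarrow> 'k::euclidean_space"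
  assumes h: "linear h" and E: "affine E" "bij_betw h E UNIV"
  obtains k where "smooth_on UNIV k" "\<And>y. k y \<in> E" "\<And>y. h (k y) = y"
proof -
  obtain a where a: "a \<in> E" using E(2) by (metis UNIV_I bij_betw_imp_surj_on image_iff)
  \<comment> \<open>a linear inverse exists on the direction space of \<open>E\<close>; the affine one is its translate\<close>
  define V where "V = (\<lambda>x. x - a) ` E"
  have "subspace V"
    using affine_diffs_subspace_subtract[OF E(1) a] by (simp add: V_def)
  moreover have "inj_on h V"
    unfolding V_def using bij_betw_imp_inj_on[OF E(2)]
    by (auto simp: inj_on_def linear_diff[OF h])
  ultimately obtain g where g: "range g \<subseteq> V" "linear g" "\<forall>v\<in>V. g (h v) = v"
    using linear_exists_left_inverse_on[OF h] by blast
  have hg: "h (g y) = y" for y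
  proof -
    obtain x where "x \<in> E" "h x = y + h a" using E(2) by (metis UNIV_I bij_betw_imp_surj_on image_iff)
    then have "x - a \<in> V" "h (x - a) = y" by (auto simp: V_def linear_diff[OF h])
    then show ?thesis using g(3) by metis
  qed
  show thesis
  proof
    show "smooth_on UNIV (\<lambda>y. (a - g (h a)) + g y)"
      by (intro smooth_on_add smooth_on_const smooth_on_bounded_linear linear_conv_bounded_linear[THEN iffD1] g)
    fix y
    show "h ((a - g (h a)) + g y) = y"
      by (simp add: linear_add[OF h] linear_diff[OF h] hg)
    have "g (y - h a) \<in> V" using g(1) by blast
    then show "(a - g (h a)) + g y \<in> E"
      unfolding V_def by (auto simp: linear_diff[OF g(2)] algebra_simps)
  qed
qed

text \<open>
  The image of \<open>\<pi> \<circ> j\<close> has the subspace topology on one side and the quotient topology on the other. They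
  agree because \<open>\<Omega>\<close> is a neighbourhood of the plane \<open>range j\<close> that contains no other point over the
  image: if \<open>V\<close> is open in the model space, then the points of \<open>\<Omega>\<close> that the left inverse \<open>r\<close> of \<open>j\<close> sends to
  \<open>V\<close> form an open set, and its image under \<open>\<pi>\<close> meets that of the plane exactly in the image of \<open>V\<close>.
\<close>

lemma subtopology_quotient_range:
  fixes \<pi> :: "'e::euclidean_space \<Rightarrow> 'a" and j :: "'k::euclidean_space \<Rightarrow> 'e"
  assumes \<pi>: "smooth_deck \<pi>"
    and j: "continuous_on UNIV j" and r: "continuous_on UNIV r" "\<And>t. r (j t) = t"
    and \<Omega>: "open \<Omega>" "range j \<subseteq> \<Omega>" "\<And>x. x \<in> \<Omega> \<Longrightarrow> \<pi> x \<in> range (\<pi> \<circ> j) \<Longrightarrow> x \<in> range j"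
  shows "subtopology (quotient_topology \<pi>) (range (\<pi> \<circ> j)) = quotient_topology (\<pi> \<circ> j)"
proof (subst topology_eq, rule allI)
  fix U
  show "openin (subtopology (quotient_topology \<pi>) (range (\<pi> \<circ> j))) U \<longleftrightarrow>
    openin (quotient_topology (\<pi> \<circ> j)) U"
  proof
    assume "openin (subtopology (quotient_topology \<pi>) (range (\<pi> \<circ> j))) U"
    then obtain V where V: "open (\<pi> -` V)" "U = V \<inter> range (\<pi> \<circ> j)"
      by (auto simp: openin_subtopology openin_quotient_topology)
    have "open (j -` (\<pi> -` V))" using continuous_open_preimage[OF j open_UNIV V(1)] by simp
    moreover have "(\<pi> \<circ> j) -` U = j -` (\<pi> -` V)" using V(2) by auto
    ultimately show "openin (quotient_topology (\<pi> \<circ> j)) U"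
      using V(2) by (simp add: openin_quotient_topology)
  next
    assume "openin (quotient_topology (\<pi> \<circ> j)) U"
    then have U: "U \<subseteq> range (\<pi> \<circ> j)" "open ((\<pi> \<circ> j) -` U)" by (simp_all add: openin_quotient_topology)
    define W where "W = \<Omega> \<inter> r -` ((\<pi> \<circ> j) -` U)"
    have "open (r -` ((\<pi> \<circ> j) -` U))" using continuous_open_preimage[OF r(1) open_UNIV U(2)] by simp
    then have "open W" using \<Omega>(1) by (simp add: W_def open_Int)
    then have "openin (quotient_topology \<pi>) (\<pi> ` W)" by (rule openin_quotient_image[OF \<pi>])
    moreover have "U = \<pi> ` W \<inter> range (\<pi> \<circ> j)"
    proof (intro equalityI subsetI)
      fix p assume p: "p \<in> U"
      then obtain t where t: "p = \<pi> (j t)" using U(1) by auto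
      then have "j t \<in> W" using \<Omega>(2) r(2) p by (auto simp: W_def)
      then show "p \<in> \<pi> ` W \<inter> range (\<pi> \<circ> j)" using t by auto
    next
      fix p assume p: "p \<in> \<pi> ` W \<inter> range (\<pi> \<circ> j)"
      then obtain x where x: "p = \<pi> x" "x \<in> W" by auto
      then have "x \<in> \<Omega>" "\<pi> x \<in> range (\<pi> \<circ> j)" using p by (auto simp: W_def)
      then obtain t where "x = j t" using \<Omega>(3) by blast
      then show "p \<in> U" using x r(2) by (auto simp: W_def)
    qed
    ultimately show "openin (subtopology (quotient_topology \<pi>) (range (\<pi> \<circ> j))) U"
      unfolding openin_subtopology by blast
  qed
qed

text \<open>
  The difficulty lies in the sections. A section of \<open>\<phi> \<circ> \<pi>\<close> over the slice takes values over the image of \<open>\<pi> \<circ> j\<close>. A deck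
  transformation moves its value at one point into the plane \<open>range j\<close>. By continuity the nearby values
  are then in \<open>\<Omega>\<close>, hence in the plane, and applying \<open>r\<close> turns them into values in the model space.
\<close>

lemma slice_chart_adapted:
  fixes \<pi> :: "'e::euclidean_space \<Rightarrow> 'a" and j :: "'k::euclidean_space \<Rightarrow> 'e"
  assumes \<pi>: "smooth_deck \<pi>" "locally_injective \<pi>"
    and j: "smooth_on UNIV j" and r: "smooth_on UNIV r" "\<And>t. r (j t) = t"
    and \<Omega>: "open \<Omega>" "range j \<subseteq> \<Omega>" "\<And>x. x \<in> \<Omega> \<Longrightarrow> \<pi> x \<in> range (\<pi> \<circ> j) \<Longrightarrow> x \<in> range j"
    and c: "c \<in> (slice_charts (quotient_manifold \<pi>) (range (\<pi> \<circ> j)) :: ('a, 'k) chart set)"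
  shows "adapted_chart (\<pi> \<circ> j) c"
proof -
  define L where "L = range (\<pi> \<circ> j)"
  obtain U \<phi> and h :: "'e \<Rightarrow> 'k" and E where c_eq: "c = (U \<inter> L, h \<circ> \<phi>)"
    and max: "(U, \<phi>) \<in> maximal_atlas (quotient_manifold \<pi>)" and h: "linear h"
    and E: "affine E" "\<phi> ` (U \<inter> L) = \<phi> ` U \<inter> E" "bij_betw h E UNIV"
    using c unfolding slice_charts_def L_def by blast
  have ad: "adapted_chart \<pi> (U, \<phi>)" by (rule maximal_atlas_adapted[OF \<pi> max])
  have inj: "inj_on \<phi> U" and oU: "open (\<pi> -` U)" and sm: "smooth_on (\<pi> -` U) (\<phi> \<circ> \<pi>)"
    using ad by (simp_all add: adapted_chart_def)
  have pre: "(\<pi> \<circ> j) -` (U \<inter> L) = j -` (\<pi> -` U)" by (auto simp: L_def)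
  have "inj_on (h \<circ> \<phi>) (U \<inter> L)"
  proof (rule comp_inj_on)
    show "inj_on \<phi> (U \<inter> L)" using inj by (rule inj_on_subset) auto
    show "inj_on h (\<phi> ` (U \<inter> L))"
      using bij_betw_imp_inj_on[OF E(3)] by (rule inj_on_subset) (simp add: E(2))
  qed
  moreover have "open ((\<pi> \<circ> j) -` (U \<inter> L))"
    unfolding pre using continuous_open_preimage[OF smooth_on_imp_continuous_on[OF j] open_UNIV oU] by simp
  moreover have "smooth_on ((\<pi> \<circ> j) -` (U \<inter> L)) ((h \<circ> \<phi>) \<circ> (\<pi> \<circ> j))"
  proof -
    have "smooth_on (j -` (\<pi> -` U)) ((\<phi> \<circ> \<pi>) \<circ> j)"
      by (rule smooth_on_compose[OF smooth_on_subset[OF j] sm]) auto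
    then have "smooth_on (j -` (\<pi> -` U)) (h \<circ> ((\<phi> \<circ> \<pi>) \<circ> j))"
      by (rule smooth_on_compose[OF _ smooth_on_bounded_linear[of h UNIV]])
        (use h in \<open>auto simp: linear_conv_bounded_linear\<close>)
    then show ?thesis unfolding pre by (simp add: o_assoc)
  qed
  moreover have "\<exists>N s. open N \<and> y \<in> N \<and> smooth_on N s \<and>
      (\<forall>z\<in>N. (\<pi> \<circ> j) (s z) \<in> U \<inter> L \<and> (h \<circ> \<phi>) ((\<pi> \<circ> j) (s z)) = z)" if y: "y \<in> (h \<circ> \<phi>) ` (U \<inter> L)" for y
  proof -
    obtain p where p: "p \<in> U" "p \<in> L" "y = h (\<phi> p)" using y by auto
    then obtain t where "p = \<pi> (j t)" by (auto simp: L_def)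
    with p have t: "\<pi> (j t) \<in> U" "y = h (\<phi> (\<pi> (j t)))" by auto
    obtain k where k: "smooth_on UNIV k" "\<And>y. k y \<in> E" "\<And>y. h (k y) = y"
      using linear_bij_affine_inverse[OF h E(1,3)] by metis
    have ky: "k y = \<phi> (\<pi> (j t))"
    proof -
      have "\<phi> (\<pi> (j t)) \<in> \<phi> ` (U \<inter> L)" using t(1) by (auto simp: L_def)
      then have "\<phi> (\<pi> (j t)) \<in> E" using E(2) by auto
      then show ?thesis using k t(2) bij_betw_imp_inj_on[OF E(3)] by (auto dest: inj_onD)
    qed
    then have "k y \<in> \<phi> ` U" using t(1) by simp
    then obtain N0 s0 where N0: "open N0" "k y \<in> N0" "N0 \<subseteq> \<phi> ` U" "smooth_on N0 s0"
      and s0: "\<And>z. z \<in> N0 \<Longrightarrow> \<pi> (s0 z) = the_inv_into U \<phi> z"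
      by (rule adapted_chartE[OF ad]) (rule that)
    have "\<pi> (s0 (k y)) = \<pi> (j t)"
      using s0[OF N0(2)] ky the_inv_into_f_f[OF inj t(1)] by simp
    then obtain g where g: "smooth_on UNIV g" "g (s0 (k y)) = j t" "\<And>z. \<pi> (g z) = \<pi> z"
      by (rule smooth_deckE[OF \<pi>(1)]) (rule that)
    \<comment> \<open>the section moved by \<open>g\<close> to pass through \<open>j t\<close>, and the open set where it stays in \<open>\<Omega>\<close>\<close>
    define s1 where "s1 = g \<circ> (s0 \<circ> k)"
    define N where "N = (k -` N0) \<inter> s1 -` \<Omega>"
    have okN: "open (k -` N0)"
      using continuous_open_preimage[OF smooth_on_imp_continuous_on[OF k(1)] open_UNIV N0(1)] by simp
    have s1: "smooth_on (k -` N0) s1"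
      unfolding s1_def
      by (intro smooth_on_compose[OF _ g(1)] smooth_on_compose[OF _ N0(4)] smooth_on_subset[OF k(1)]) auto
    have "open N"
      unfolding N_def by (rule continuous_open_preimage[OF smooth_on_imp_continuous_on[OF s1] okN \<Omega>(1)])
    moreover have "y \<in> N" using N0(2) g(2) \<Omega>(2) by (auto simp: N_def s1_def)
    moreover have "smooth_on N (r \<circ> s1)"
      by (rule smooth_on_compose[OF smooth_on_subset[OF s1] r(1)]) (auto simp: N_def)
    moreover have "(\<pi> \<circ> j) ((r \<circ> s1) z) \<in> U \<inter> L \<and> (h \<circ> \<phi>) ((\<pi> \<circ> j) ((r \<circ> s1) z)) = z" if "z \<in> N" for z
    proof -
      have z: "k z \<in> N0" "s1 z \<in> \<Omega>" using that by (auto simp: N_def)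
      then have "k z \<in> \<phi> ` (U \<inter> L)" using N0(3) k(2) E(2) by auto
      then obtain p where p: "p \<in> U" "p \<in> L" "k z = \<phi> p" by auto
      have "\<pi> (s1 z) = p"
        using s0[OF z(1)] the_inv_into_f_f[OF inj p(1)] p(3) by (simp add: s1_def g(3))
      moreover from this have "s1 z \<in> range j" using \<Omega>(3)[OF z(2)] p(2) by (simp add: L_def)
      then have "j (r (s1 z)) = s1 z" using r(2) by auto
      ultimately show ?thesis using p k(3)[of z] by simp
    qed
    ultimately show ?thesis by (intro exI[of _ N] exI[of _ "r \<circ> s1"]) blast
  qed
  ultimately show ?thesis by (simp add: adapted_chart_def c_eq)
qed

text \<open>
  On a small open set \<open>W \<subseteq> \<Omega>\<close> that meets the plane, the local inverse of \<open>\<pi>\<close> maps the trace of the image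
  onto the trace of the plane, so it is a slice chart, and \<open>r\<close> identifies the plane with the model space.
\<close>

lemma slice_charts_cover:
  fixes \<pi> :: "'e::euclidean_space \<Rightarrow> 'a" and j :: "'k::euclidean_space \<Rightarrow> 'e"
  assumes \<pi>: "smooth_deck \<pi>" "locally_injective \<pi>"
    and j: "affine (range j)" and r: "linear r" "\<And>t. r (j t) = t"
    and \<Omega>: "open \<Omega>" "range j \<subseteq> \<Omega>" "\<And>x. x \<in> \<Omega> \<Longrightarrow> \<pi> x \<in> range (\<pi> \<circ> j) \<Longrightarrow> x \<in> range j"
  shows "(\<Union>c\<in>(slice_charts (quotient_manifold \<pi>) (range (\<pi> \<circ> j)) :: ('a, 'k) chart set). fst c)
    = range (\<pi> \<circ> j)"
proof (intro equalityI subsetI)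
  fix p assume "p \<in> range (\<pi> \<circ> j)"
  then obtain t where t: "p = \<pi> (j t)" by auto
  obtain W0 where W0: "open W0" "j t \<in> W0" "inj_on \<pi> W0"
    using \<pi>(2) unfolding locally_injective_def by blast
  define W where "W = W0 \<inter> \<Omega>"
  have W: "open W" "j t \<in> W" "inj_on \<pi> W"
    using W0 \<Omega>(1,2) inj_on_subset[of \<pi> W0 W] by (auto simp: W_def)
  have inv: "the_inv_into W \<pi> (\<pi> w) = w" if "w \<in> W" for w
    using the_inv_into_f_f[OF W(3) that] .
  let ?d = "(\<pi> ` W, the_inv_into W \<pi>)"
  have ad: "adapted_chart \<pi> ?d" by (rule quotient_chart_adapted[OF \<pi>(1) W(1,3)])
  have "compatible_charts ?d d" if "d \<in> snd (quotient_manifold \<pi>)" for d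
    using smooth_in_adapted_charts[OF ad quotient_manifold_adapted[OF \<pi>(1) that], of id]
      smooth_in_adapted_charts[OF quotient_manifold_adapted[OF \<pi>(1) that] ad, of id]
    by (simp add: compatible_charts_def)
  then have "?d \<in> maximal_atlas (quotient_manifold \<pi>)"
    using adapted_chart_is_chart[OF ad] by (auto simp: maximal_atlas_def quotient_manifold_def)
  moreover have "the_inv_into W \<pi> ` (\<pi> ` W \<inter> range (\<pi> \<circ> j)) = the_inv_into W \<pi> ` \<pi> ` W \<inter> range j"
  proof (intro equalityI subsetI)
    fix x assume "x \<in> the_inv_into W \<pi> ` (\<pi> ` W \<inter> range (\<pi> \<circ> j))"
    then obtain w where w: "w \<in> W" "\<pi> w \<in> range (\<pi> \<circ> j)" "x = w" using inv by auto
    then have "x \<in> range j" using \<Omega>(3)[of w] by (auto simp: W_def)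
    then show "x \<in> the_inv_into W \<pi> ` \<pi> ` W \<inter> range j" using w inv[of w] by force
  next
    fix x assume "x \<in> the_inv_into W \<pi> ` \<pi> ` W \<inter> range j"
    then obtain w s where w: "w \<in> W" "x = w" "x = j s" using inv by auto
    then have "\<pi> w \<in> \<pi> ` W \<inter> range (\<pi> \<circ> j)" by auto
    then show "x \<in> the_inv_into W \<pi> ` (\<pi> ` W \<inter> range (\<pi> \<circ> j))" using inv[OF w(1)] w(2) by (metis image_eqI)
  qed
  moreover have "bij_betw r (range j) UNIV"
    using r(2) by (intro bij_betwI[of _ _ _ j]) auto
  ultimately have "(\<pi> ` W \<inter> range (\<pi> \<circ> j), r \<circ> the_inv_into W \<pi>) \<in> slice_charts (quotient_manifold \<pi>) (range (\<pi> \<circ> j))"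
    using j r(1) unfolding slice_charts_def by blast
  moreover have "p \<in> \<pi> ` W \<inter> range (\<pi> \<circ> j)" using t W(2) by auto
  ultimately show "p \<in> (\<Union>c\<in>(slice_charts (quotient_manifold \<pi>) (range (\<pi> \<circ> j)) :: ('a, 'k) chart set). fst c)"
    by (intro UN_I) (assumption, simp only: fst_conv)
qed (auto simp: slice_charts_def)

theorem submanifold_diffeomorphic_quotient:
  fixes \<pi> :: "'e::euclidean_space \<Rightarrow> 'a" and j :: "'k::euclidean_space \<Rightarrow> 'e" and \<rho> :: "'k \<Rightarrow> 'b"
  assumes \<pi>: "smooth_deck \<pi>" "locally_injective \<pi>"
    and \<rho>: "smooth_deck \<rho>" "locally_injective \<rho>" "Hausdorff_space (quotient_topology \<rho>)"
    and j: "smooth_on UNIV j" "affine (range j)" and r: "linear r" "\<And>t. r (j t) = t"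
    and \<Omega>: "open \<Omega>" "range j \<subseteq> \<Omega>" "\<And>x. x \<in> \<Omega> \<Longrightarrow> \<pi> x \<in> range (\<pi> \<circ> j) \<Longrightarrow> x \<in> range j"
    and fib: "\<And>s t. \<pi> (j s) = \<pi> (j t) \<longleftrightarrow> \<rho> s = \<rho> t"
  shows "diffeomorphic (submanifold (quotient_manifold \<pi>) (range (\<pi> \<circ> j)) :: ('a, 'k) manifold)
    (quotient_manifold \<rho>)"
proof -
  have sr: "smooth_on UNIV r" using r(1) by (simp add: smooth_on_bounded_linear linear_conv_bounded_linear)
  have "(submanifold (quotient_manifold \<pi>) (range (\<pi> \<circ> j)) :: ('a, 'k) manifold)
      = (quotient_topology (\<pi> \<circ> j), slice_charts (quotient_manifold \<pi>) (range (\<pi> \<circ> j)))"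
    using subtopology_quotient_range[OF \<pi>(1) smooth_on_imp_continuous_on[OF j(1)]
        smooth_on_imp_continuous_on[OF sr] r(2) \<Omega>]
    by (simp add: submanifold_def quotient_manifold_def)
  moreover have "quotient_manifold \<rho> = (quotient_topology \<rho>, snd (quotient_manifold \<rho>))"
    by (simp add: quotient_manifold_def)
  moreover have "diffeomorphic
      (quotient_topology (\<pi> \<circ> j), slice_charts (quotient_manifold \<pi>) (range (\<pi> \<circ> j)) :: ('a, 'k) chart set)
      (quotient_topology \<rho>, snd (quotient_manifold \<rho>))"
  proof (rule diffeomorphic_same_fibres)
    show "(\<pi> \<circ> j) s = (\<pi> \<circ> j) t \<longleftrightarrow> \<rho> s = \<rho> t" for s t using fib by simp
    show "adapted_chart (\<pi> \<circ> j) c"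
      if "c \<in> (slice_charts (quotient_manifold \<pi>) (range (\<pi> \<circ> j)) :: ('a, 'k) chart set)" for c
      by (rule slice_chart_adapted[OF \<pi> j(1) sr r(2) \<Omega> that])
    show "(\<Union>c\<in>(slice_charts (quotient_manifold \<pi>) (range (\<pi> \<circ> j)) :: ('a, 'k) chart set). fst c)
        = range (\<pi> \<circ> j)"
      by (rule slice_charts_cover[OF \<pi> j(2) r \<Omega>])
    show "adapted_chart \<rho> c" if "c \<in> snd (quotient_manifold \<rho>)" for c
      by (rule quotient_manifold_adapted[OF \<rho>(1) that])
    show "(\<Union>c\<in>snd (quotient_manifold \<rho>). fst c) = range \<rho>"
      by (rule quotient_charts_cover[OF \<rho>(2)])
  qed (use \<rho> second_countable_quotient in auto)
  ultimately show ?thesis by simp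
qed


section \<open>The torus\<close>

lemma integer_lattice_0: "0 \<in> integer_lattice"
  by (simp add: integer_lattice_def)

lemma integer_lattice_add: "u \<in> integer_lattice \<Longrightarrow> v \<in> integer_lattice \<Longrightarrow> u + v \<in> integer_lattice"
  by (simp add: integer_lattice_def)

lemma integer_lattice_minus: "v \<in> integer_lattice \<Longrightarrow> - v \<in> integer_lattice"
  by (simp add: integer_lattice_def)

lemma integer_lattice_norm_less_1:
  assumes "k \<in> integer_lattice" "norm k < 1"
  shows "k = 0"
proof -
  have "k $ i = 0" for i
  proof -
    have "k $ i \<in> \<int>" "\<bar>k $ i\<bar> < 1"
      using assms component_le_norm_cart[of k i] by (auto simp: integer_lattice_def)
    then show ?thesis by (metis Ints_nonzero_abs_less1)
  qed
  then show ?thesis by (simp add: vec_eq_iff)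
qed

abbreviation torus_proj :: "real ^ 'n \<Rightarrow> (real ^ 'n) set" where
  "torus_proj v \<equiv> integer_lattice #>\<^bsub>additive_group\<^esub> v"

lemma torus_proj_eq_iff: "torus_proj s = torus_proj t \<longleftrightarrow> s - t \<in> integer_lattice"
proof -
  have *: "torus_proj v = {x. x - v \<in> integer_lattice}" for v :: "real ^ 'n"
    by (force simp: r_coset_def additive_group_def)
  show ?thesis
  proof
    assume "torus_proj s = torus_proj t"
    then show "s - t \<in> integer_lattice" using integer_lattice_0 by (auto simp: *)
  next
    assume st: "s - t \<in> integer_lattice"
    have "x - s \<in> integer_lattice \<longleftrightarrow> x - t \<in> integer_lattice" for x
      using integer_lattice_add[OF st, of "x - s"]
        integer_lattice_add[OF integer_lattice_minus[OF st], of "x - t"] by auto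
    then show "torus_proj s = torus_proj t" by (simp add: *)
  qed
qed

lemma smooth_deck_torus: "smooth_deck (torus_proj :: real ^ 'n \<Rightarrow> _)"
  unfolding smooth_deck_def
proof (intro allI impI)
  fix x y :: "real ^ 'n" assume "torus_proj x = torus_proj y"
  then show "\<exists>g. smooth_on UNIV g \<and> g x = y \<and> (\<forall>z. torus_proj (g z) = torus_proj z)"
    using integer_lattice_minus[of "x - y"]
    by (intro exI[of _ "\<lambda>z. z + (y - x)"])
      (auto simp: torus_proj_eq_iff intro!: smooth_on_add smooth_on_id smooth_on_const)
qed

lemma locally_injective_torus: "locally_injective (torus_proj :: real ^ 'n \<Rightarrow> _)"
  unfolding locally_injective_def
proof
  fix x :: "real ^ 'n"
  have "inj_on torus_proj (ball x (1 / 2))"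
  proof (rule inj_onI)
    fix s t assume st: "s \<in> ball x (1 / 2)" "t \<in> ball x (1 / 2)" "torus_proj s = torus_proj t"
    have "dist s t < 1" using st(1,2) dist_triangle_half_r[of x s 1 t] by (simp add: dist_commute)
    then have "s - t = 0"
      using st(3) by (intro integer_lattice_norm_less_1) (simp_all add: torus_proj_eq_iff dist_norm)
    then show "s = t" by simp
  qed
  then show "\<exists>W. open W \<and> x \<in> W \<and> inj_on torus_proj W"
    by (intro exI[of _ "ball x (1 / 2)"]) auto
qed

lemma cis_2pi_eq_iff: "cis (2 * pi * a) = cis (2 * pi * b) \<longleftrightarrow> a - b \<in> \<int>"
proof -
  have "cis (2 * pi * a) = cis (2 * pi * b) \<longleftrightarrow> (\<exists>n::int. 2 * pi * a = 2 * pi * b + 2 * pi * n)"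
    unfolding complex_eq_iff sin_cos_eq_iff[symmetric] by auto
  also have "\<dots> \<longleftrightarrow> (\<exists>n::int. a - b = n)"
  proof (rule ex_cong1)
    fix n :: int
    have "2 * pi * a = 2 * pi * b + 2 * pi * n \<longleftrightarrow> 2 * pi * (a - b - n) = 0" by (simp add: algebra_simps)
    then show "2 * pi * a = 2 * pi * b + 2 * pi * n \<longleftrightarrow> a - b = n" by auto
  qed
  finally show ?thesis by (auto simp: Ints_def)
qed

text \<open>
  The torus maps injectively and continuously into \<open>\<complex>\<^sup>n\<close> by the exponential of each coordinate.
\<close>

lemma Hausdorff_torus: "Hausdorff_space (quotient_topology (torus_proj :: real ^ 'n \<Rightarrow> _))"
proof -
  define F :: "real ^ 'n \<Rightarrow> complex ^ 'n" where "F v = (\<chi> i. cis (2 * pi * v $ i))" for v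
  define f where "f p = F (inv_into UNIV torus_proj p)" for p
  have F: "F s = F t \<longleftrightarrow> torus_proj s = torus_proj t" for s t
    unfolding torus_proj_eq_iff
    by (simp add: F_def vec_eq_iff cis_2pi_eq_iff integer_lattice_def)
  have f: "f (torus_proj x) = F x" for x
    unfolding f_def F by (rule f_inv_into_f) simp
  have cF: "continuous_on UNIV F"
    unfolding F_def by (intro continuous_on_vec_lambda continuous_intros)
  have "continuous_map (quotient_topology torus_proj) euclidean f"
    unfolding continuous_map_def
  proof (intro conjI allI impI)
    fix U :: "(complex ^ 'n) set" assume "openin euclidean U"
    then have "open (F -` U)" using continuous_open_preimage[OF cF open_UNIV] by simp
    moreover have "torus_proj -` {p \<in> topspace (quotient_topology torus_proj). f p \<in> U} = F -` U"
      by (auto simp: topspace_quotient_topology f)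
    ultimately show "openin (quotient_topology torus_proj)
        {p \<in> topspace (quotient_topology torus_proj). f p \<in> U}"
      by (auto simp: openin_quotient_topology topspace_quotient_topology)
  qed auto
  moreover have "inj_on f (topspace (quotient_topology torus_proj))"
    unfolding topspace_quotient_topology using f F by (auto simp: inj_on_def)
  ultimately show ?thesis
    using Hausdorff_space_injective_preimage[OF Hausdorff_space_euclidean] by blast
qed


section \<open>The lattice of the Nakamura manifold\<close>

lemma linear_Re: "linear Re" and linear_Im: "linear Im"
  by (auto intro: linearI)

lemma vec2_eta: "vector [v $ 1, v $ 2] = (v :: real ^ 2)"
  by (simp add: vec_eq_iff forall_2)

text \<open>
  For \<open>f = Re\<close> and \<open>f = Im\<close> these are the coordinates of the \<open>(z\<^sub>1, z\<^sub>2)\<close>-part with respect to a basis of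
  \<open>P\<int>\<^sup>2 \<oplus> iP\<int>\<^sup>2\<close>. Taking \<open>f\<close> as a parameter lets real and imaginary parts exchange their roles between
  the two foliations.
\<close>

definition lattice_coords :: "real ^ 2 ^ 2 \<Rightarrow> (complex \<Rightarrow> real) \<Rightarrow> complex \<times> complex \<times> complex \<Rightarrow> real ^ 2" where
  "lattice_coords P f p = matrix_inv P *v vector [f (fst (snd p)), f (snd (snd p))]"

lemma linear_lattice_coords:
  assumes "linear f"
  shows "linear (lattice_coords P f)"
proof (rule linearI)
  fix p q :: "complex \<times> complex \<times> complex" and c :: real
  have "vector [f (fst (snd (p + q))), f (snd (snd (p + q)))]
      = (vector [f (fst (snd p)), f (snd (snd p))] + vector [f (fst (snd q)), f (snd (snd q))] :: real ^ 2)"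
    by (simp add: vec_eq_iff forall_2 linear_add[OF assms])
  then show "lattice_coords P f (p + q) = lattice_coords P f p + lattice_coords P f q"
    by (simp add: lattice_coords_def matrix_vector_right_distrib)
  have "vector [f (fst (snd (c *\<^sub>R p))), f (snd (snd (c *\<^sub>R p)))]
      = (c *\<^sub>R vector [f (fst (snd p)), f (snd (snd p))] :: real ^ 2)"
    by (simp add: vec_eq_iff forall_2 linear_scale[OF assms])
  then show "lattice_coords P f (c *\<^sub>R p) = c *\<^sub>R lattice_coords P f p"
    by (simp add: lattice_coords_def matrix_vector_mult_scaleR)
qed

lemma matrix_inv_vector:
  fixes P :: "real ^ 'n ^ 'n"
  assumes "invertible P"
  shows "matrix_inv P *v (P *v v) = v" "P *v (matrix_inv P *v v) = v"
  using assms someI_ex[of "\<lambda>A'. P ** A' = mat 1 \<and> A' ** P = mat 1"]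
  by (simp_all add: matrix_vector_mul_assoc invertible_def matrix_inv_def)

lemma mem_image_lattice_iff:
  fixes P :: "real ^ 'n ^ 'n"
  assumes "invertible P"
  shows "v \<in> (*v) P ` integer_lattice \<longleftrightarrow> matrix_inv P *v v \<in> integer_lattice"
  using matrix_inv_vector[OF assms] by (metis image_iff)

lemma mem_nakamura_lattice_iff:
  assumes P: "invertible P" and \<tau>: "\<tau> \<noteq> 0"
  shows "p \<in> nakamura_lattice P \<tau> \<longleftrightarrow> Re (fst p) \<in> \<int> \<and> Im (fst p) / \<tau> \<in> \<int> \<and>
     lattice_coords P Re p \<in> integer_lattice \<and> lattice_coords P Im p \<in> integer_lattice"
    (is "_ \<longleftrightarrow> ?R p")
proof
  assume "p \<in> nakamura_lattice P \<tau>"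
  then show "?R p"
    using \<tau> by (auto simp: nakamura_lattice_def lattice_coords_def vec2_eta matrix_inv_vector[OF P])
next
  assume R: "?R p"
  obtain w a b where p: "p = (w, a, b)" by (cases p)
  let ?u = "vector [Re a, Re b] :: real ^ 2" and ?v = "vector [Im a, Im b] :: real ^ 2"
  have "?u \<in> (*v) P ` integer_lattice" "?v \<in> (*v) P ` integer_lattice"
    using R by (simp_all add: mem_image_lattice_iff[OF P] lattice_coords_def p)
  then show "p \<in> nakamura_lattice P \<tau>"
    using R \<tau> unfolding nakamura_lattice_def mem_Collect_eq
    by (intro exI[of _ "Re w"] exI[of _ "Im w / \<tau>"] exI[of _ ?u] exI[of _ ?v]) (simp add: p)
qed

definition stretch :: "real \<Rightarrow> real ^ 2 \<Rightarrow> real ^ 2" where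
  "stretch a v = vector [exp a * v $ 1, exp (- a) * v $ 2]"

lemma stretch_add: "stretch (a + b) v = stretch a (stretch b v)"
  by (simp add: stretch_def vec_eq_iff forall_2 mult.assoc[symmetric] flip: exp_add)

lemma stretch_0: "stretch 0 v = v"
  by (simp add: stretch_def vec_eq_iff forall_2)

text \<open>
  In the basis given by \<open>P\<close> the map \<open>stretch lam\<close> is the integer matrix \<open>M\<close>, whose inverse, the adjugate
  since \<open>det M = 1\<close>, is also an integer matrix. So \<open>P\<int>\<^sup>2\<close> is mapped onto itself, and hence by all integer
  iterates.
\<close>

lemma stretch_preserves_lattice:
  fixes M :: "int ^ 2 ^ 2" and P :: "real ^ 2 ^ 2"
  assumes M: "det M = 1" and P: "invertible P"
    and conj: "P ** map_matrix real_of_int M ** matrix_inv P = vector [vector [exp lam, 0], vector [0, exp (- lam)]]"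
    and v: "v \<in> (*v) P ` integer_lattice" and m: "m \<in> \<int>"
  shows "stretch (lam * m) v \<in> (*v) P ` integer_lattice"
proof -
  let ?\<Lambda> = "(*v) P ` integer_lattice"
  let ?M = "map_matrix real_of_int M"
  have stretch_P: "stretch lam (P *v k) = P *v (?M *v k)" for k
  proof -
    have "stretch lam (P *v k) = (P ** ?M ** matrix_inv P) *v (P *v k)"
      unfolding conj stretch_def by (simp add: vec_eq_iff forall_2 matrix_vector_mult_def sum_2)
    also have "\<dots> = P *v (?M *v (matrix_inv P *v (P *v k)))"
      by (simp add: matrix_vector_mul_assoc matrix_mul_assoc)
    finally show ?thesis by (simp add: matrix_inv_vector[OF P])
  qed
  have up: "stretch lam v \<in> ?\<Lambda>" if v: "v \<in> ?\<Lambda>" for v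
  proof -
    obtain k where k: "k \<in> integer_lattice" "v = P *v k" using v by auto
    have "?M *v k \<in> integer_lattice"
      using k(1) by (simp add: integer_lattice_def matrix_vector_mult_def map_matrix_def sum_2)
    then show ?thesis using k(2) stretch_P by auto
  qed
  have down: "stretch (- lam) v \<in> ?\<Lambda>" if v: "v \<in> ?\<Lambda>" for v
  proof -
    obtain k where k: "k \<in> integer_lattice" "v = P *v k" using v by auto
    \<comment> \<open>the adjugate of \<open>M\<close> applied to \<open>k\<close>\<close>
    define k' :: "real ^ 2" where
      "k' = vector [M $ 2 $ 2 * k $ 1 - M $ 1 $ 2 * k $ 2, M $ 1 $ 1 * k $ 2 - M $ 2 $ 1 * k $ 1]"
    have k': "k' \<in> integer_lattice"
      using k(1) by (simp add: integer_lattice_def k'_def forall_2)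
    have det: "real_of_int (M $ 1 $ 1) * M $ 2 $ 2 - real_of_int (M $ 1 $ 2) * M $ 2 $ 1 = 1"
      using M unfolding det_2 by (metis of_int_1 of_int_diff of_int_mult)
    have "?M *v k' = k"
    proof -
      have "(?M *v k') $ i = (real_of_int (M $ 1 $ 1) * M $ 2 $ 2 - real_of_int (M $ 1 $ 2) * M $ 2 $ 1) * k $ i"
        if "i = 1 \<or> i = 2" for i
        using that by (auto simp: k'_def matrix_vector_mult_def map_matrix_def sum_2 algebra_simps)
      then show ?thesis unfolding det by (simp add: vec_eq_iff forall_2)
    qed
    then have "stretch lam (P *v k') = v" using stretch_P k(2) by simp
    then have "stretch (- lam) v = P *v k'"
      using stretch_add[of "- lam" lam "P *v k'"] by (simp add: stretch_0)
    then show ?thesis using k' by auto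
  qed
  have nat: "stretch (lam * real n) v \<in> ?\<Lambda> \<and> stretch (- (lam * real n)) v \<in> ?\<Lambda>" for n
  proof (induction n)
    case (Suc n)
    have "lam * real (Suc n) = lam + lam * real n"
      "- (lam * real (Suc n)) = - lam + - (lam * real n)" by (simp_all add: algebra_simps)
    then show ?case using Suc up down by (simp only: stretch_add)
  qed (use v in \<open>simp add: stretch_0\<close>)
  obtain i where i: "m = of_int i" using m by (auto elim: Ints_cases)
  show ?thesis
  proof (cases "i \<ge> 0")
    case True
    then have "m = real (nat i)" using i by simp
    then show ?thesis using nat[of "nat i"] by simp
  next
    case False
    then have "m = - real (nat (- i))" using i by simp
    then show ?thesis using nat[of "nat (- i)"] by simp
  qed
qed

lemma nakamura_mult_simps:
  "fst (p \<otimes>\<^bsub>nakamura_group lam\<^esub> q) = fst p + fst q"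
  "fst (snd (p \<otimes>\<^bsub>nakamura_group lam\<^esub> q)) = of_real (exp (lam * Re (fst p))) * fst (snd q) + fst (snd p)"
  "snd (snd (p \<otimes>\<^bsub>nakamura_group lam\<^esub> q)) = of_real (exp (- lam * Re (fst p))) * snd (snd q) + snd (snd p)"
  by (auto simp: nakamura_group_def split: prod.splits)

lemma lattice_coords_mult:
  assumes P: "invertible P" and f: "f = Re \<or> f = Im"
  shows "P *v lattice_coords P f (p \<otimes>\<^bsub>nakamura_group lam\<^esub> q)
    = stretch (lam * Re (fst p)) (P *v lattice_coords P f q) + P *v lattice_coords P f p"
  using f
  by (auto simp: lattice_coords_def matrix_inv_vector[OF P] nakamura_mult_simps stretch_def vec_eq_iff forall_2)

locale nakamura =
  fixes lam \<tau> :: real and M :: "int ^ 2 ^ 2" and P :: "real ^ 2 ^ 2"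
  assumes \<tau>: "\<tau> \<noteq> 0" and M: "det M = 1" and P: "invertible P"
    and conj: "P ** map_matrix real_of_int M ** matrix_inv P
      = vector [vector [exp lam, 0], vector [0, exp (- lam)]]"
begin

abbreviation "G \<equiv> nakamura_group lam"
abbreviation "\<Gamma> \<equiv> nakamura_lattice P \<tau>"
abbreviation "proj \<equiv> nakamura_proj lam P \<tau>"
abbreviation "coords \<equiv> lattice_coords P"

lemma coords_in_lattice_iff: "coords f p \<in> integer_lattice \<longleftrightarrow> P *v coords f p \<in> (*v) P ` integer_lattice"
  by (simp add: mem_image_lattice_iff[OF P] matrix_inv_vector[OF P])

lemma coords_mult_in_lattice:
  assumes f: "f = Re \<or> f = Im" and "Re (fst p) \<in> \<int>"
    and "coords f p \<in> integer_lattice" "coords f q \<in> integer_lattice"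
  shows "coords f (p \<otimes>\<^bsub>G\<^esub> q) \<in> integer_lattice"
proof -
  have "stretch (lam * Re (fst p)) (P *v coords f q) \<in> (*v) P ` integer_lattice"
    using assms by (intro stretch_preserves_lattice[OF M P conj]) auto
  then obtain k where "k \<in> integer_lattice" "stretch (lam * Re (fst p)) (P *v coords f q) = P *v k" by auto
  then have "P *v coords f (p \<otimes>\<^bsub>G\<^esub> q) = P *v (k + coords f p)"
    unfolding lattice_coords_mult[OF P f] by (simp add: matrix_vector_right_distrib)
  then show ?thesis
    unfolding coords_in_lattice_iff
    using integer_lattice_add[OF \<open>k \<in> integer_lattice\<close> assms(3)] by auto
qed

lemma subgroup_lattice: "subgroup \<Gamma> G"
proof -
  interpret group G by (rule group_nakamura_group)
  show ?thesis
  proof (rule subgroupI)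
    show "\<Gamma> \<noteq> {}"
    proof -
      have "coords f 0 = 0" if "f = Re \<or> f = Im" for f
        using that linear_0[OF linear_lattice_coords] linear_Re linear_Im by blast
      then have "0 \<in> \<Gamma>" by (simp add: mem_nakamura_lattice_iff[OF P \<tau>] integer_lattice_0)
      then show ?thesis by blast
    qed
    show "p \<otimes>\<^bsub>G\<^esub> q \<in> \<Gamma>" if "p \<in> \<Gamma>" "q \<in> \<Gamma>" for p q
      using that coords_mult_in_lattice[of Re p q] coords_mult_in_lattice[of Im p q]
      by (simp add: mem_nakamura_lattice_iff[OF P \<tau>] nakamura_mult_simps add_divide_distrib)
    show "inv\<^bsub>G\<^esub> p \<in> \<Gamma>" if p: "p \<in> \<Gamma>" for p
    proof -
      define q where "q = (- fst p, - (of_real (exp (- lam * Re (fst p))) * fst (snd p)),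
        - (of_real (exp (lam * Re (fst p))) * snd (snd p)))"
      have "q \<otimes>\<^bsub>G\<^esub> p = \<one>\<^bsub>G\<^esub>" by (simp add: q_def nakamura_group_def split: prod.splits)
      then have "inv\<^bsub>G\<^esub> p = q" by (intro inv_equality) (simp_all add: nakamura_group_def)
      moreover have "coords f q \<in> integer_lattice" if f: "f = Re \<or> f = Im" "coords f p \<in> integer_lattice" for f
      proof -
        have "stretch (lam * - Re (fst p)) (P *v coords f p) \<in> (*v) P ` integer_lattice"
          using p f by (intro stretch_preserves_lattice[OF M P conj])
            (auto simp: mem_nakamura_lattice_iff[OF P \<tau>])
        then obtain k where k: "k \<in> integer_lattice" "stretch (lam * - Re (fst p)) (P *v coords f p) = P *v k" by auto
        have "P *v coords f q = - stretch (lam * - Re (fst p)) (P *v coords f p)"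
          using f(1) by (auto simp: q_def lattice_coords_def matrix_inv_vector[OF P] stretch_def vec_eq_iff forall_2)
        also have "\<dots> = P *v (- k)" unfolding k(2) by (simp add: linear_neg[OF matrix_vector_mul_linear])
        finally show ?thesis
          unfolding coords_in_lattice_iff using integer_lattice_minus[OF k(1)] by auto
      qed
      ultimately show ?thesis
        using p by (simp add: mem_nakamura_lattice_iff[OF P \<tau>]) (simp add: q_def)
    qed
  qed (simp add: nakamura_group_def)
qed

lemma proj_eq_iff: "proj x = proj y \<longleftrightarrow> (\<exists>\<gamma>\<in>\<Gamma>. y = \<gamma> \<otimes>\<^bsub>G\<^esub> x)"
proof -
  interpret group G by (rule group_nakamura_group)
  have carr: "z \<in> carrier G" for z by (simp add: nakamura_group_def)
  show ?thesis
  proof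
    assume "proj x = proj y"
    then have "y \<in> proj x" using rcos_self[OF carr subgroup_lattice] by (simp add: nakamura_proj_def)
    then show "\<exists>\<gamma>\<in>\<Gamma>. y = \<gamma> \<otimes>\<^bsub>G\<^esub> x" by (auto simp: nakamura_proj_def r_coset_def)
  next
    assume "\<exists>\<gamma>\<in>\<Gamma>. y = \<gamma> \<otimes>\<^bsub>G\<^esub> x"
    then have "y \<in> \<Gamma> #>\<^bsub>G\<^esub> x" by (auto simp: r_coset_def)
    then show "proj x = proj y"
      unfolding nakamura_proj_def by (rule repr_independence[OF _ carr subgroup_lattice])
  qed
qed

lemma smooth_deck_proj: "smooth_deck proj"
  unfolding smooth_deck_def
proof (intro allI impI)
  fix x y assume "proj x = proj y"
  then obtain \<gamma> where \<gamma>: "\<gamma> \<in> \<Gamma>" "y = \<gamma> \<otimes>\<^bsub>G\<^esub> x" unfolding proj_eq_iff by blast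
  let ?l = "\<lambda>z::complex \<times> complex \<times> complex. (fst z, exp (lam * Re (fst \<gamma>)) *\<^sub>R fst (snd z),
    exp (- lam * Re (fst \<gamma>)) *\<^sub>R snd (snd z))"
  have eq: "\<gamma> \<otimes>\<^bsub>G\<^esub> z = \<gamma> + ?l z" for z
    by (simp add: prod_eq_iff nakamura_mult_simps scaleR_conv_of_real)
  have "linear ?l" by (rule linearI) (simp_all add: algebra_simps)
  then have "smooth_on UNIV (\<lambda>z. \<gamma> \<otimes>\<^bsub>G\<^esub> z)"
    unfolding eq
    by (intro smooth_on_add smooth_on_const smooth_on_bounded_linear linear_conv_bounded_linear[THEN iffD1])
  moreover have "proj (\<gamma> \<otimes>\<^bsub>G\<^esub> z) = proj z" for z
    using \<gamma>(1) proj_eq_iff[of z "\<gamma> \<otimes>\<^bsub>G\<^esub> z"] by auto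
  ultimately show "\<exists>g. smooth_on UNIV g \<and> g x = y \<and> (\<forall>z. proj (g z) = proj z)"
    using \<gamma>(2) by (intro exI[of _ "\<lambda>z. \<gamma> \<otimes>\<^bsub>G\<^esub> z"]) simp
qed

text \<open>
  An element of \<open>\<Gamma>\<close> that relates two points with nearby \<open>x\<close>-coordinates shifts \<open>x\<close> by an integer less
  than 1 in absolute value, that is, not at all; the stretching factors are then trivial and it is a
  translation.
\<close>

lemma proj_eq_iff_near:
  assumes "\<bar>Re (fst x) - Re (fst y)\<bar> < 1"
  shows "proj x = proj y \<longleftrightarrow> Re (fst x) = Re (fst y) \<and> (Im (fst x) - Im (fst y)) / \<tau> \<in> \<int> \<and>
    coords Re x - coords Re y \<in> integer_lattice \<and> coords Im x - coords Im y \<in> integer_lattice"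
    (is "_ \<longleftrightarrow> ?R")
proof -
  have diff: "coords f (y - x) = coords f y - coords f x" if "f = Re \<or> f = Im" for f
    using that linear_diff[OF linear_lattice_coords] linear_Re linear_Im by blast
  have "?R \<longleftrightarrow> Re (fst x) = Re (fst y) \<and> y - x \<in> \<Gamma>"
  proof -
    have "a - b \<in> integer_lattice \<longleftrightarrow> b - a \<in> integer_lattice" for a b :: "real ^ 2"
      using integer_lattice_minus[of "a - b"] integer_lattice_minus[of "b - a"] by auto
    moreover have "(Im (fst x) - Im (fst y)) / \<tau> \<in> \<int> \<longleftrightarrow> (Im (fst y) - Im (fst x)) / \<tau> \<in> \<int>"
      by (metis Ints_minus minus_diff_eq minus_divide_left)
    ultimately show ?thesis by (auto simp: mem_nakamura_lattice_iff[OF P \<tau>] diff)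
  qed
  also have "\<dots> \<longleftrightarrow> (\<exists>\<gamma>\<in>\<Gamma>. Re (fst \<gamma>) = 0 \<and> y = \<gamma> + x)"
    by (auto intro!: bexI[of _ "y - x"])
  also have "\<dots> \<longleftrightarrow> (\<exists>\<gamma>\<in>\<Gamma>. Re (fst \<gamma>) = 0 \<and> y = \<gamma> \<otimes>\<^bsub>G\<^esub> x)"
  proof -
    have "\<gamma> \<otimes>\<^bsub>G\<^esub> x = \<gamma> + x" if "Re (fst \<gamma>) = 0" for \<gamma>
      using that by (simp add: prod_eq_iff nakamura_mult_simps)
    then show ?thesis by metis
  qed
  also have "\<dots> \<longleftrightarrow> proj x = proj y"
  proof -
    have "Re (fst \<gamma>) = 0" if "\<gamma> \<in> \<Gamma>" "y = \<gamma> \<otimes>\<^bsub>G\<^esub> x" for \<gamma>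
    proof -
      have "Re (fst \<gamma>) \<in> \<int>" using that(1) by (simp add: mem_nakamura_lattice_iff[OF P \<tau>])
      moreover have "\<bar>Re (fst \<gamma>)\<bar> < 1" using that(2) assms by (simp add: nakamura_mult_simps)
      ultimately show ?thesis by (metis Ints_nonzero_abs_less1)
    qed
    then show ?thesis unfolding proj_eq_iff by blast
  qed
  finally show ?thesis by simp
qed

lemma continuous_coords: "f = Re \<or> f = Im \<Longrightarrow> continuous_on UNIV (coords f)"
  using linear_lattice_coords linear_Re linear_Im linear_continuous_on linear_conv_bounded_linear by metis

lemma coords_eq_imp: 
  assumes "coords f p = coords f q"
  shows "f (fst (snd p)) = f (fst (snd q))" "f (snd (snd p)) = f (snd (snd q))"
proof -
  have "P *v coords f p = P *v coords f q" using assms by simp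
  then show "f (fst (snd p)) = f (fst (snd q))" "f (snd (snd p)) = f (snd (snd q))"
    by (simp_all add: lattice_coords_def matrix_inv_vector[OF P] vec_eq_iff forall_2)
qed

lemma locally_injective_proj: "locally_injective proj"
  unfolding locally_injective_def
proof
  fix x
  \<comment> \<open>within \<open>W\<close>, any two points have integer coordinate differences only if these vanish\<close>
  define W where "W = {p. \<bar>Re (fst p) - Re (fst x)\<bar> < 1 / 2} \<inter> {p. \<bar>Im (fst p) / \<tau> - Im (fst x) / \<tau>\<bar> < 1 / 2}
    \<inter> {p. dist (coords Re p) (coords Re x) < 1 / 2} \<inter> {p. dist (coords Im p) (coords Im x) < 1 / 2}"
  have "open W"
    unfolding W_def
    using \<tau> by (intro open_Int open_Collect_less continuous_intros continuous_coords) auto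
  moreover have "inj_on proj W"
  proof (rule inj_onI)
    fix p q assume pq: "p \<in> W" "q \<in> W" "proj p = proj q"
    have near: "\<bar>a - b\<bar> < 1" if "\<bar>a - c\<bar> < 1 / 2" "\<bar>b - c\<bar> < 1 / 2" for a b c :: real
      using that by linarith
    have "\<bar>Re (fst p) - Re (fst q)\<bar> < 1"
      using pq(1,2) by (intro near[of _ "Re (fst x)"]) (simp_all add: W_def)
    with pq(3) have R: "Re (fst p) = Re (fst q)" "(Im (fst p) - Im (fst q)) / \<tau> \<in> \<int>"
      "coords Re p - coords Re q \<in> integer_lattice" "coords Im p - coords Im q \<in> integer_lattice"
      using proj_eq_iff_near by blast+
    have "\<bar>(Im (fst p) - Im (fst q)) / \<tau>\<bar> < 1"
      unfolding diff_divide_distrib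
      using pq(1,2) by (intro near[of _ "Im (fst x) / \<tau>"]) (simp_all add: W_def)
    then have Im: "Im (fst p) = Im (fst q)" using R(2) \<tau> Ints_nonzero_abs_less1 by fastforce
    have "coords f p = coords f q"
      if "dist (coords f p) (coords f x) < 1 / 2" "dist (coords f q) (coords f x) < 1 / 2"
        "coords f p - coords f q \<in> integer_lattice" for f
      using integer_lattice_norm_less_1[OF that(3)] dist_triangle_half_l[OF that(1,2)] by (simp add: dist_norm)
    then have "coords Re p = coords Re q" "coords Im p = coords Im q"
      using pq(1,2) R(3,4) by (auto simp: W_def)
    with R(1) Im show "p = q"
      using coords_eq_imp by (simp add: prod_eq_iff complex_eq_iff)
  qed
  ultimately show "\<exists>W. open W \<and> x \<in> W \<and> inj_on proj W"
    by (intro exI[of _ W]) (auto simp: W_def)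
qed

section \<open>The leaves\<close>

text \<open>
  The two foliations differ in which of the real and the imaginary parts of \<open>z\<^sub>1\<close> and \<open>z\<^sub>2\<close> run along the
  leaf (\<open>dir\<close>) and which are constant on the plane over it (\<open>nrm\<close>); \<open>mk\<close> reassembles a complex number
  from the two parts. The plane is parametrised by \<open>j\<close> such that integer translations of the parameters
  correspond to translations by \<open>P\<int>\<^sup>2\<close> along the leaf and by \<open>\<tau>\<int>\<close> in the direction of \<open>y\<close>.
\<close>

lemma leaf_diffeomorphic_torus:
  fixes dir nrm :: "complex \<Rightarrow> real" and mk :: "real \<Rightarrow> real \<Rightarrow> complex"
  assumes dnm: "(dir, nrm, mk) = (Re, Im, Complex) \<or> (dir, nrm, mk) = (Im, Re, \<lambda>a b. Complex b a)"
  shows "diffeomorphic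
    (submanifold (nakamura_manifold lam P \<tau>) {proj (Complex A y, mk a B, mk b C) | a b y. True}
      :: (_, real ^ 3) manifold) (torus :: (_, real ^ 3) manifold)"
proof -
  have dir: "dir = Re \<or> dir = Im" and nrm: "nrm = Re \<or> nrm = Im" using dnm by auto
  have mk: "dir (mk a b) = a" "nrm (mk a b) = b" "mk (dir z) (nrm z) = z" for a b z
    using dnm by auto
  define j :: "real ^ 3 \<Rightarrow> complex \<times> complex \<times> complex" where
    "j t = (Complex A (\<tau> * t $ 3), mk ((P *v vector [t $ 1, t $ 2]) $ 1) B, mk ((P *v vector [t $ 1, t $ 2]) $ 2) C)" for t
  define r :: "complex \<times> complex \<times> complex \<Rightarrow> real ^ 3" where
    "r p = vector [coords dir p $ 1, coords dir p $ 2, Im (fst p) / \<tau>]" for p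
  \<comment> \<open>a slab of half-width 1, in lattice units, around the plane: no other translate of the plane enters it\<close>
  define \<Omega> where "\<Omega> = {p. \<bar>Re (fst p) - A\<bar> < 1} \<inter> {p. norm (coords nrm p - matrix_inv P *v vector [B, C]) < 1}"
  have dir_j: "coords dir (j t) = vector [t $ 1, t $ 2]" for t
    by (simp add: j_def lattice_coords_def mk vec2_eta matrix_inv_vector[OF P])
  have nrm_j: "coords nrm (j t) = matrix_inv P *v vector [B, C]" for t
    by (simp add: j_def lattice_coords_def mk)
  have rj: "r (j t) = t" for t
    using \<tau> by (simp add: r_def dir_j vec_eq_iff forall_3) (simp add: j_def)
  have r: "linear r"
  proof -
    have l: "linear (coords dir)" using dir linear_lattice_coords linear_Re linear_Im by blast
    show ?thesis
      by (rule linearI)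
        (simp_all add: r_def vec_eq_iff forall_3 linear_add[OF l] linear_scale[OF l] add_divide_distrib)
  qed
  define l where "l t = j t - j 0" for t
  have l: "linear l"
  proof -
    have lP: "linear (\<lambda>t::real ^ 3. P *v vector [t $ 1, t $ 2])"
    proof (rule linearI)
      fix s t :: "real ^ 3" and c :: real
      show "P *v vector [(s + t) $ 1, (s + t) $ 2] = P *v vector [s $ 1, s $ 2] + P *v vector [t $ 1, t $ 2]"
        by (simp add: vec_eq_iff forall_2 matrix_vector_mult_def sum_2 algebra_simps)
      show "P *v vector [(c *\<^sub>R s) $ 1, (c *\<^sub>R s) $ 2] = c *\<^sub>R (P *v vector [s $ 1, s $ 2])"
        by (simp add: vec_eq_iff forall_2 matrix_vector_mult_def sum_2 algebra_simps)
    qed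
    have "l t = (Complex 0 (\<tau> * t $ 3), mk ((P *v vector [t $ 1, t $ 2]) $ 1) 0, mk ((P *v vector [t $ 1, t $ 2]) $ 2) 0)" for t
      using dnm linear_0[OF lP] by (auto simp: l_def j_def complex_eq_iff)
    then show ?thesis
      using dnm linear_add[OF lP] linear_scale[OF lP]
      by (intro linearI) (auto simp: complex_eq_iff algebra_simps)
  qed
  have j_eq: "j = (\<lambda>t. j 0 + l t)" by (simp add: l_def fun_eq_iff)
  have smooth_j: "smooth_on UNIV j"
    by (subst j_eq) (intro smooth_on_add smooth_on_const smooth_on_bounded_linear linear_conv_bounded_linear[THEN iffD1] l)
  have affine_j: "affine (range j)"
  proof -
    have "range j = (+) (j 0) ` range l" by (subst j_eq) auto
    then show ?thesis
      using subspace_imp_affine[OF linear_subspace_image[OF l subspace_UNIV]] affine_translation by metis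
  qed
  have open_\<Omega>: "open \<Omega>"
    unfolding \<Omega>_def by (intro open_Int open_Collect_less continuous_intros continuous_coords nrm)
  have j_\<Omega>: "range j \<subseteq> \<Omega>"
    by (auto simp: \<Omega>_def nrm_j) (simp_all add: j_def)
  have only_j: "x \<in> range j" if x: "x \<in> \<Omega>" "proj x \<in> range (proj \<circ> j)" for x
  proof -
    obtain t where t: "proj x = proj (j t)" using x(2) by auto
    have "Re (fst (j t)) = A" by (simp add: j_def)
    then have near: "\<bar>Re (fst x) - Re (fst (j t))\<bar> < 1" using x(1) by (simp add: \<Omega>_def)
    have "coords nrm x - coords nrm (j t) \<in> integer_lattice"
      using t nrm unfolding proj_eq_iff_near[OF near] by auto
    then have "coords nrm x = coords nrm (j t)"
      using integer_lattice_norm_less_1[of "coords nrm x - coords nrm (j t)"] x(1)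
      by (simp add: \<Omega>_def nrm_j)
    then have "nrm (fst (snd x)) = B" "nrm (snd (snd x)) = C"
      using coords_eq_imp[of nrm x "j t"] by (simp_all add: j_def mk)
    moreover have "Re (fst x) = A"
      using t \<open>Re (fst (j t)) = A\<close> unfolding proj_eq_iff_near[OF near] by simp
    moreover have "P *v vector [r x $ 1, r x $ 2] = vector [dir (fst (snd x)), dir (snd (snd x))]"
      by (simp add: r_def vec2_eta) (simp add: lattice_coords_def matrix_inv_vector[OF P])
    ultimately have "j (r x) = x"
      using mk(3)[of "fst (snd x)"] mk(3)[of "snd (snd x)"] \<tau>
      by (simp add: j_def prod_eq_iff) (simp add: r_def complex_eq_iff)
    then show ?thesis by (metis rangeI)
  qed
  have fibres: "proj (j s) = proj (j t) \<longleftrightarrow> torus_proj s = torus_proj t" for s t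
  proof -
    have "Re (fst (j s)) = Re (fst (j t))" by (simp add: j_def)
    moreover have "(Im (fst (j s)) - Im (fst (j t))) / \<tau> = (s - t) $ 3"
      using \<tau> by (simp add: j_def diff_divide_distrib)
    moreover have "coords dir (j s) - coords dir (j t) \<in> integer_lattice \<longleftrightarrow> (s - t) $ 1 \<in> \<int> \<and> (s - t) $ 2 \<in> \<int>"
      by (simp add: dir_j integer_lattice_def forall_2)
    moreover have "coords nrm (j s) - coords nrm (j t) \<in> integer_lattice"
      by (simp add: nrm_j integer_lattice_0)
    ultimately have "proj (j s) = proj (j t) \<longleftrightarrow> (s - t) $ 1 \<in> \<int> \<and> (s - t) $ 2 \<in> \<int> \<and> (s - t) $ 3 \<in> \<int>"
      using dnm proj_eq_iff_near[of "j s" "j t"] by auto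
    also have "\<dots> \<longleftrightarrow> torus_proj s = torus_proj t"
      unfolding torus_proj_eq_iff by (simp add: integer_lattice_def forall_3)
    finally show ?thesis .
  qed
  have "diffeomorphic
      (submanifold (quotient_manifold proj) (range (proj \<circ> j)) :: (_, real ^ 3) manifold)
      (quotient_manifold torus_proj :: (_, real ^ 3) manifold)"
    by (rule submanifold_diffeomorphic_quotient[OF smooth_deck_proj locally_injective_proj
          smooth_deck_torus locally_injective_torus Hausdorff_torus smooth_j affine_j r rj open_\<Omega> j_\<Omega>])
      (erule (1) only_j, rule fibres)
  moreover have "{proj (Complex A y, mk a B, mk b C) | a b y. True} = range (proj \<circ> j)"
  proof (intro equalityI subsetI)
    fix p assume "p \<in> {proj (Complex A y, mk a B, mk b C) | a b y. True}"
    then obtain a b y where p: "p = proj (Complex A y, mk a B, mk b C)" by auto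
    have "(Complex A y, mk a B, mk b C) = j (r (Complex A y, mk a B, mk b C))"
      using \<tau> by (simp add: j_def r_def vec2_eta) (simp add: lattice_coords_def matrix_inv_vector[OF P] mk)
    then show "p \<in> range (proj \<circ> j)" unfolding p by (metis comp_apply rangeI)
  qed (auto simp: j_def)
  ultimately show ?thesis by (simp add: nakamura_manifold_def torus_def)
qed

end

theorem proposition5p5:
  fixes lam \<tau> :: real and M :: "int ^ 2 ^ 2" and P :: "real ^ 2 ^ 2"
    and L :: "(complex \<times> complex \<times> complex) set set"
  assumes "lam \<noteq> 0" and "\<tau> \<noteq> 0"
    and "det M = 1"
    and "invertible P"
    and "P ** map_matrix real_of_int M ** matrix_inv P = vector [vector [exp lam, 0], vector [0, exp (- lam)]]"
    and "L \<in> foliation_234 lam P \<tau> \<union> foliation_456 lam P \<tau>"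
  shows "diffeomorphic
    (submanifold (nakamura_manifold lam P \<tau>) L :: (_, real ^ 3) manifold)
    (torus :: (_, real ^ 3) manifold)"
proof -
  interpret nakamura lam \<tau> M P
    using assms(2-5) by unfold_locales
  from assms(6) consider
      (L234) A B C where "L = {proj (Complex A y, Complex x\<^sub>1 B, Complex x\<^sub>2 C) | x\<^sub>1 x\<^sub>2 y. True}"
    | (L456) A B C where "L = {proj (Complex A y, Complex B y\<^sub>1, Complex C y\<^sub>2) | y y\<^sub>1 y\<^sub>2. True}"
    unfolding foliation_234_def foliation_456_def nakamura_point_def by blast
  then show ?thesis
  proof cases
    case L234
    then show ?thesis using leaf_diffeomorphic_torus[of Re Im Complex A B C] by simp
  next
    case L456
    then have "L = {proj (Complex A y, Complex B a, Complex C b) | a b y. True}" by blast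
    then show ?thesis using leaf_diffeomorphic_torus[of Im Re "\<lambda>a b. Complex b a" A B C] by simp
  qed
qed

end
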